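(* $\partial^{-1}(\mathscr{H}^2 \odot \partial \mathscr{H}^2) \subseteq \mathscr{H}^1$.
   Context: $\mathscr{H}^2$ is the Hilbert space of Dirichlet series $f(s)=\sum_{n\ge1}a_nn^{-s}$ with $\|f\|_{\mathscr{H}^2}=(\sum_{n\ge1}|a_n|^2)^{1/2}<\infty$; $f(+\infty)=a_1$; $f'$ denotes the derivative $f'(s)=-\sum_{n\ge2}a_n(\log n)n^{-s}$. The skew product space $\partial^{-1}(\mathscr{H}^2 \odot \partial \mathscr{H}^2)$ is the Banach space completion of the space of Dirichlet series $F$ whose derivatives have a finite sum representation $F'=\sum_kf_kg_k'$ with $f_k,g_k\in\mathscr{H}^2$, under the norm $\|F\|=|F(+\infty)|+\inf\sum_k\|f_k\|_{\mathscr{H}^2}\|g_k\|_{\mathscr{H}^2}$, where the infimum is over all finite representations; it is regarded as a space of Dirichlet series. For $n=\prod_jp_j^{\kappa_j}$ ($p_j$ the $j$th prime) put $\kappa(n)=(\kappa_1,\kappa_2,\dots)$; the Bohr lift of $f$ is $\mathscr{B}f(z)=\sum_na_nz^{\kappa(n)}$, $z\in\mathbb{T}^\infty$. $\mathscr{H}^1$ is the space of Dirichlet series $f$ with $\mathscr{B}f\in H^1(\mathbb{T}^\infty)$ (the closure of analytic polynomials in $L^1(\mathbb{T}^\infty,m_\infty)$, $m_\infty$ the normalized Haar measure), with norm $\|f\|_{\mathscr{H}^1}=\int_{\mathbb{T}^\infty}|\mathscr{B}f|\,dm_\infty$. *)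

theory Defs
  imports "HOL-Probability.Probability" "HOL-Computational_Algebra.Primes"
    "HOL-Library.Infinite_Set"
begin

(* A Dirichlet series sum_{n >= 1} a_n n^{-s} is identified with its coefficient sequence
   a :: nat => complex.  The unused index 0 always carries the value 0, so that equality of
   series is equality of functions. *)

type_synonym dseries = "nat \<Rightarrow> complex"

definition ds_deriv :: "dseries \<Rightarrow> dseries" where
  "ds_deriv a n = - a n * complex_of_real (ln (real n))"

(* The product of two Dirichlet series.  At n = 0 the index set is infinite and the sum is 0. *)
definition ds_mult :: "dseries \<Rightarrow> dseries \<Rightarrow> dseries" where
  "ds_mult a b n = (\<Sum>d | d dvd n. a d * b (n div d))"

definition H2 :: "dseries set" where
  "H2 = {a. a 0 = 0 \<and> summable (\<lambda>n. (cmod (a n))\<^sup>2)}"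

definition H2_norm :: "dseries \<Rightarrow> real" where
  "H2_norm a = sqrt (\<Sum>n. (cmod (a n))\<^sup>2)"

definition skew_rep :: "dseries \<Rightarrow> nat \<Rightarrow> (nat \<Rightarrow> dseries) \<Rightarrow> (nat \<Rightarrow> dseries) \<Rightarrow> bool" where
  "skew_rep F K f g \<longleftrightarrow>
     (\<forall>k<K. f k \<in> H2 \<and> g k \<in> H2) \<and>
     ds_deriv F = (\<lambda>n. \<Sum>k<K. ds_mult (f k) (ds_deriv (g k)) n)"

definition skew_pre :: "dseries set" where
  "skew_pre = {F. F 0 = 0 \<and> (\<exists>K f g. skew_rep F K f g)}"

(* F(+infinity) is the first coefficient F 1. *)
definition skew_norm :: "dseries \<Rightarrow> real" where
  "skew_norm F = cmod (F 1) +
     Inf {(\<Sum>k<K. H2_norm (f k) * H2_norm (g k)) | K f g. skew_rep F K f g}"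

(* The completion, regarded as a space of Dirichlet series.  Every coefficient functional is
   bounded with respect to skew_norm, hence extends continuously to the completion: the
   element represented by a Cauchy sequence X is the Dirichlet series whose coefficients are
   the limits of the coefficients of X. *)
definition skew_product_space :: "dseries set" where
  "skew_product_space = {F. \<exists>X :: nat \<Rightarrow> dseries.
     (\<forall>m. X m \<in> skew_pre) \<and>
     (\<forall>\<epsilon>>0. \<exists>N. \<forall>m\<ge>N. \<forall>l\<ge>N. skew_norm (\<lambda>n. X m n - X l n) < \<epsilon>) \<and>
     (\<forall>n. (\<lambda>m. X m n) \<longlonglongrightarrow> F n)}"

definition circle_measure :: "complex measure" where
  "circle_measure =
     distr (uniform_measure lborel {0..<2 * pi}) (restrict_space borel (sphere 0 1)) cis"

(* The normalized Haar measure of the infinite torus is the product of the normalized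
   arc length measures. *)
definition torus_measure :: "(nat \<Rightarrow> complex) measure" where
  "torus_measure = PiM UNIV (\<lambda>_. circle_measure)"

definition monomial :: "(nat \<Rightarrow> nat) \<Rightarrow> (nat \<Rightarrow> complex) \<Rightarrow> complex" where
  "monomial \<alpha> z = (\<Prod>j | \<alpha> j \<noteq> 0. z j ^ \<alpha> j)"

definition analytic_polynomials :: "((nat \<Rightarrow> complex) \<Rightarrow> complex) set" where
  "analytic_polynomials = {(\<lambda>z. \<Sum>\<alpha>\<in>A. c \<alpha> * monomial \<alpha> z) | A c.
     finite A \<and> (\<forall>\<alpha>\<in>A. finite {j. \<alpha> j \<noteq> 0})}"

definition H1_torus :: "((nat \<Rightarrow> complex) \<Rightarrow> complex) set" where
  "H1_torus = {u. integrable torus_measure u \<and>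
     (\<forall>\<epsilon>>0. \<exists>\<phi>\<in>analytic_polynomials. (LINT z|torus_measure. cmod (u z - \<phi> z)) < \<epsilon>)}"

(* Primes are numbered from 0: nth_prime 0 = 2. *)
definition nth_prime :: "nat \<Rightarrow> nat" where
  "nth_prime = enumerate {p. prime p}"

definition kappa :: "nat \<Rightarrow> nat \<Rightarrow> nat" where
  "kappa n j = multiplicity (nth_prime j) n"

(* u is the Bohr lift of a: the series sum_n a_n z^(kappa n) is the Fourier series of u.  The
   exponents kappa n, n >= 1, are exactly the finitely supported sequences of nonnegative
   integers; the remaining Fourier coefficients of an element of H1_torus vanish. *)
definition is_bohr_lift :: "dseries \<Rightarrow> ((nat \<Rightarrow> complex) \<Rightarrow> complex) \<Rightarrow> bool" where
  "is_bohr_lift a u \<longleftrightarrow>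
     (\<forall>n\<ge>1. (LINT z|torus_measure. u z * cnj (monomial (kappa n) z)) = a n)"

definition H1 :: "dseries set" where
  "H1 = {a. a 0 = 0 \<and> (\<exists>u\<in>H1_torus. is_bohr_lift a u)}"

end

theory Submission
  imports Defs "HOL-Complex_Analysis.Complex_Analysis" "HOL-Real_Asymp.Real_Asymp"
begin

text \<open>
  If \<open>F' = f g'\<close> with Dirichlet polynomials \<open>f\<close>, \<open>g\<close>, then
  \<open>\<integral> \<bar>F\<bar> \<le> C \<parallel>f\<parallel> \<parallel>g\<parallel>\<close> on the torus is shown by duality. Let \<open>h\<close> be a trigonometric
  polynomial with \<open>\<bar>h\<bar> \<le> 1\<close>. Its Poisson extension \<open>u\<^sub>t = a\<^sub>t + cnj b\<^sub>t\<close> along the flow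
  \<open>z\<^sub>j \<mapsto> z\<^sub>j p\<^sub>j\<^sup>i\<^sup>x\<close> satisfies \<open>\<bar>u\<^sub>t\<bar> \<le> 1\<close>, with \<open>a\<^sub>t\<close> and \<open>b\<^sub>t\<close> analytic along the flow. The
  Littlewood-Paley identity writes the pairing of \<open>F\<close> and \<open>h\<close> as
  \<open>\<integral> 4 t \<langle>f\<^sub>t g\<^sub>t', a\<^sub>t'\<rangle> dt\<close>, so it remains to prove the Carleson type bound
  \<open>\<integral> 4 t \<parallel>f\<^sub>t a\<^sub>t'\<parallel>\<^sup>2 dt \<le> C \<parallel>f\<parallel>\<^sup>2\<close>. It follows from the pointwise inequality
  \<open>\<Delta> \<bar>u f\<bar>\<^sup>2 \<ge> 4 \<bar>a' f + u f'\<bar>\<^sup>2 - 4 \<bar>f'\<bar>\<^sup>2\<close> and the Littlewood-Paley identity again. General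
  elements of the skew product space are limits in \<open>L\<^sup>1\<close> of such \<open>F\<close>.
\<close>

section \<open>Characters of the infinite torus\<close>

text \<open>Only the derivative of \<open>F\<close> is a product, not \<open>F\<close> itself, so
  the Cauchy-Schwarz inequality alone gives no L^1 bound; the Littlewood-Paley identity is what
  brings the derivative into the pairing. The test function h is bounded, but the part of it that
  \<open>F\<close> sees, the part a of nonnegative frequencies, need not be: the projection onto
  these frequencies is unbounded in the sup norm. Hence the bound for a' cannot rest on |a f|; it
  rests on the harmonic function u = a + cnj b, which inherits the bound of h. Although u f is not
  analytic, |u f|^2 is the sum of |a f|^2, 2 Re (a f b cnj f) and |b f|^2, each built from an
  analytic function times the conjugate of one, so the same identity integrates its Laplacian. The
  flow replaces infinitely many variables by the single real frequency ln m - ln n of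
  \<open>chi m z * cnj (chi n z)\<close>, and for finite sums everything is an exact computation
  with exponentials. The constant is 7/2 = 1/2 + 3: the part 1/2 comes from g, the part 3 = 1 + 2
  from the boundary value of |u f|^2 and from the correction term |f'|^2.\<close>

abbreviation chi :: "nat \<Rightarrow> (nat \<Rightarrow> complex) \<Rightarrow> complex" where
  "chi n \<equiv> monomial (kappa n)"

lemma prime_nth_prime: "prime (nth_prime j)"
  unfolding nth_prime_def using enumerate_in_set[OF primes_infinite] by auto

lemma inj_nth_prime: "inj nth_prime"
  unfolding nth_prime_def using strict_mono_enumerate[OF primes_infinite]
  by (rule strict_mono_imp_inj_on)

lemma nth_prime_surj: "prime p \<Longrightarrow> \<exists>j. nth_prime j = p"
  unfolding nth_prime_def using range_enumerate[OF primes_infinite] by (metis mem_Collect_eq rangeE)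

lemma finite_kappa:
  assumes "n \<ge> 1" shows "finite {j. kappa n j \<noteq> 0}"
proof -
  have "{j. kappa n j \<noteq> 0} \<subseteq> nth_prime -` prime_factors n"
    using assms by (auto simp: kappa_def prime_factors_multiplicity prime_nth_prime)
  moreover have "finite (nth_prime -` prime_factors n)"
    by (intro finite_vimageI inj_nth_prime) auto
  ultimately show ?thesis by (rule finite_subset)
qed

lemma chi_eq_prod:
  assumes "finite J" "{j. kappa n j \<noteq> 0} \<subseteq> J"
  shows "chi n z = (\<Prod>j\<in>J. z j ^ kappa n j)"
  unfolding monomial_def using assms by (intro prod.mono_neutral_left) auto

lemma kappa_mult: "m \<ge> 1 \<Longrightarrow> n \<ge> 1 \<Longrightarrow> kappa (m * n) j = kappa m j + kappa n j"
  unfolding kappa_def using prime_nth_prime[of j]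
  by (intro prime_elem_multiplicity_mult_distrib) auto

lemma kappa_inject:
  assumes "m \<ge> 1" "n \<ge> 1" "kappa m = kappa n" shows "m = n"
proof (rule multiplicity_eq_nat)
  fix p :: nat assume "prime p"
  then obtain j where "nth_prime j = p" using nth_prime_surj by blast
  then show "multiplicity p m = multiplicity p n"
    using assms(3) by (auto simp: kappa_def dest: fun_cong[where x = j])
qed (use assms in auto)

lemma chi_mult:
  assumes "m \<ge> 1" "n \<ge> 1" shows "chi (m * n) z = chi m z * chi n z"
proof -
  let ?J = "{j. kappa m j \<noteq> 0} \<union> {j. kappa n j \<noteq> 0}"
  have J: "finite ?J" using assms finite_kappa by auto
  show ?thesis
    using assms
    by (simp add: chi_eq_prod[OF J] kappa_mult subset_iff power_add prod.distrib)
qed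

lemma kappa_nth_prime: "kappa (nth_prime i) j = (if i = j then 1 else 0)"
proof -
  have "nth_prime j \<noteq> nth_prime i" if "i \<noteq> j"
    using that inj_nth_prime by (auto dest: injD)
  then show ?thesis
    unfolding kappa_def using prime_nth_prime[of i] prime_nth_prime[of j]
    by (auto simp: prime_multiplicity_other)
qed

lemma chi_nth_prime: "chi (nth_prime i) z = z i"
proof -
  have "{j. kappa (nth_prime i) j \<noteq> 0} = {i}" by (auto simp: kappa_nth_prime)
  then show ?thesis by (simp add: monomial_def kappa_nth_prime)
qed

lemma chi_1: "chi (Suc 0) z = 1"
  by (simp add: monomial_def kappa_def)

lemma space_torus: "space torus_measure = {z. \<forall>j. cmod (z j) = 1}"
  by (auto simp: torus_measure_def space_PiM circle_measure_def space_restrict_space)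

lemma norm_monomial: "z \<in> space torus_measure \<Longrightarrow> cmod (monomial \<alpha> z) = 1"
  by (simp add: monomial_def prod_norm norm_power space_torus flip: prod_norm)

text \<open>The witness rotates the coordinate of the prime p by p^(ix). Both sides of the claim are
  completely multiplicative in \<open>n\<close>, so agreement at primes suffices. On Dirichlet
  series this is the vertical translation from s to s - ix.\<close>

lemma torus_flow:
  assumes "z \<in> space torus_measure"
  obtains w where "w \<in> space torus_measure"
    "\<And>n. n \<ge> 1 \<Longrightarrow> chi n w = chi n z * cis (x * ln (real n))"
proof
  define w where "w = (\<lambda>j. z j * cis (x * ln (real (nth_prime j))))"
  show "w \<in> space torus_measure"
    using assms by (simp add: space_torus w_def norm_mult)
  fix n :: nat assume "n \<ge> 1"
  then show "chi n w = chi n z * cis (x * ln (real n))"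
  proof (induction n rule: prime_divisors_induct)
    case (unit n)
    then show ?case by (simp add: chi_1)
  next
    case (factor p n)
    then have p: "p \<ge> 1" and n: "n \<ge> 1" using prime_ge_1_nat by (auto simp: Suc_le_eq)
    obtain j where j: "p = nth_prime j" using nth_prime_surj factor by metis
    show ?case
      using factor p n
      by (simp add: chi_mult ln_mult distrib_left flip: cis_mult)
         (simp add: j chi_nth_prime w_def)
  qed auto
qed

section \<open>Haar measure and orthonormality of the characters\<close>

lemma borel_measurable_cnj [measurable (raw)]:
  "f \<in> borel_measurable M \<Longrightarrow> (\<lambda>x. cnj (f x)) \<in> borel_measurable M"
  by (rule measurable_compose[of f M borel cnj])
     (auto intro!: borel_measurable_continuous_onI continuous_intros)

lemma borel_measurable_cis [measurable]: "cis \<in> borel_measurable borel"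
  by (intro borel_measurable_continuous_onI continuous_intros)

lemma circle_measurable: "cis \<in> uniform_measure lborel {0..<2 * pi} \<rightarrow>\<^sub>M restrict_space borel (sphere 0 1)"
proof (rule measurable_restrict_space2)
  have "cis \<in> borel_measurable lborel"
    by measurable
  then show "cis \<in> borel_measurable (uniform_measure lborel {0..<2 * pi})"
    by (simp cong: measurable_cong_sets)
qed auto

lemma prob_space_circle: "prob_space circle_measure"
  unfolding circle_measure_def
  by (intro prob_space.prob_space_distr prob_space_uniform_measure circle_measurable) auto

lemma sets_circle: "sets circle_measure = sets (restrict_space borel (sphere 0 1))"
  by (simp add: circle_measure_def)

interpretation torus: product_prob_space "\<lambda>_. circle_measure" UNIV
  by (intro product_prob_spaceI prob_space_circle)

lemma prob_space_torus: "prob_space torus_measure"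
  unfolding torus_measure_def by (rule torus.prob_space_axioms)

lemma measurable_circle: "f \<in> borel_measurable borel \<Longrightarrow> f \<in> borel_measurable circle_measure"
  using measurable_restrict_space1[of f borel borel "sphere 0 1"] measurable_cong_sets[OF sets_circle refl]
  by blast

lemma measurable_circle_component:
  assumes "j \<in> J" "f \<in> borel_measurable borel"
  shows "(\<lambda>z. f (z j)) \<in> borel_measurable (PiM J (\<lambda>_. circle_measure))"
  using measurable_compose[OF measurable_component_singleton[of j J "\<lambda>_. circle_measure"]
      measurable_circle] assms by blast

lemma integral_cis:
  assumes "k \<noteq> 0"
  shows "(\<integral>x. indicator {0..<2*pi} x *\<^sub>R cis (of_int k * x) \<partial>lborel) = 0"
proof -
  let ?F = "\<lambda>x. cis (of_int k * x) / (\<i> * of_int k)"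
  have "has_bochner_integral lborel (\<lambda>x. indicator {0..2*pi} x *\<^sub>R cis (of_int k * x))
      (?F (2*pi) - ?F 0)"
  proof (rule has_bochner_integral_FTC_Icc)
    fix x :: real
    have "(cis has_vector_derivative (\<i> * cis t)) (at t within A)" for t A
      unfolding cis_conv_exp
      by (rule has_vector_derivative_real_field) (auto intro!: derivative_eq_intros)
    note D = this
    have "((\<lambda>x. cis (of_int k * x)) has_vector_derivative (of_int k *\<^sub>R (\<i> * cis (of_int k * x))))
       (at x within {0..2*pi})"
      by (rule vector_diff_chain_within[OF _ D, unfolded o_def]) (auto intro!: derivative_eq_intros)
    then have "(?F has_vector_derivative (of_int k *\<^sub>R (\<i> * cis (of_int k * x))) / (\<i> * of_int k))
       (at x within {0..2*pi})"
      by (rule has_vector_derivative_divide)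
    then show "(?F has_vector_derivative cis (of_int k * x)) (at x within {0..2*pi})"
      using assms by (simp add: scaleR_conv_of_real field_simps)
  qed (auto intro!: continuous_intros)
  moreover have "?F (2*pi) = ?F 0"
    using cis_multiple_2pi[of "of_int k"] by (simp add: mult_ac)
  ultimately have "(\<integral>x. indicator {0..2*pi} x *\<^sub>R cis (of_int k * x) \<partial>lborel) = 0"
    by (simp add: has_bochner_integral_iff)
  also have "(\<integral>x. indicator {0..2*pi} x *\<^sub>R cis (of_int k * x) \<partial>lborel) =
     (\<integral>x. indicator {0..<2*pi} x *\<^sub>R cis (of_int k * x) \<partial>lborel)"
    using AE_lborel_singleton[of "2*pi"]
    by (intro integral_cong_AE) (measurable, auto elim!: eventually_mono split: split_indicator)
  finally show ?thesis .
qed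

lemma integral_circle_power:
  "(\<integral>z. z ^ k * cnj (z ^ l) \<partial>circle_measure) = (if k = l then 1 else 0)"
proof (cases "k = l")
  case True
  have "(\<integral>z. z ^ k * cnj (z ^ l) \<partial>circle_measure) = (\<integral>z. 1 \<partial>circle_measure)"
    using True
    by (intro Bochner_Integration.integral_cong)
       (auto simp: circle_measure_def space_restrict_space simp flip: complex_norm_square power_mult_distrib)
  with True show ?thesis using prob_space.prob_space[OF prob_space_circle] by simp
next
  case False
  have "(\<integral>z. z ^ k * cnj (z ^ l) \<partial>circle_measure) =
      (\<integral>x. cis x ^ k * cnj (cis x ^ l) \<partial>uniform_measure lborel {0..<2 * pi})"
    unfolding circle_measure_def
    by (intro integral_distr circle_measurable measurable_restrict_space1) measurable
  also have "\<dots> = (\<integral>x. cis (of_int (int k - int l) * x) \<partial>uniform_measure lborel {0..<2 * pi})"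
    by (simp add: Complex.DeMoivre cis_cnj cis_mult algebra_simps)
  also have "\<dots> = (\<integral>x. (indicator {0..<2*pi} x / (2*pi)) *\<^sub>R cis (of_int (int k - int l) * x) \<partial>lborel)"
  proof -
    have "uniform_measure lborel {0..<2 * pi} = density lborel (\<lambda>x. ennreal (indicator {0..<2*pi} x / (2*pi)))"
      unfolding uniform_measure_def
      by (intro density_cong) (auto split: split_indicator simp: divide_ennreal simp flip: ennreal_1)
    then show ?thesis
      by (simp add: integral_density)
  qed
  also have "\<dots> = (\<integral>x. (1/(2*pi)) *\<^sub>R (indicator {0..<2*pi} x *\<^sub>R cis (of_int (int k - int l) * x)) \<partial>lborel)"
    by (intro Bochner_Integration.integral_cong) auto
  also have "\<dots> = 0"
    using integral_cis[of "int k - int l"] False by (subst integral_scaleR_right) simp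
  finally show ?thesis using False by simp
qed

text \<open>Only the finitely many coordinates in \<open>J\<close> occur, so the integral factors
  over a finite product of circles. For distinct integers unique factorization provides a coordinate
  whose factor is 0.\<close>

lemma integral_chi:
  assumes "m \<ge> 1" "n \<ge> 1"
  shows "(\<integral>z. chi m z * cnj (chi n z) \<partial>torus_measure) = (if m = n then 1 else 0)"
proof -
  define J where "J = {j. kappa m j \<noteq> 0} \<union> {j. kappa n j \<noteq> 0}"
  have J: "finite J" using assms finite_kappa by (auto simp: J_def)
  let ?g = "\<lambda>j z. z ^ kappa m j * cnj (z ^ kappa n j)"
  have meas: "?g j \<in> borel_measurable circle_measure" for j
    by (intro measurable_circle) measurable
  have int: "integrable circle_measure (?g j)" for j
    by (intro finite_measure.integrable_const_bound[where B = 1] meas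
        prob_space.finite_measure[OF prob_space_circle])
       (auto simp: circle_measure_def space_restrict_space norm_mult norm_power)
  have "(\<integral>z. chi m z * cnj (chi n z) \<partial>torus_measure) = (\<integral>z. (\<Prod>j\<in>J. ?g j (z j)) \<partial>torus_measure)"
    by (intro Bochner_Integration.integral_cong refl, subst (1 2) chi_eq_prod[OF J])
       (auto simp: J_def prod.distrib)
  also have "\<dots> = (\<integral>z. (\<Prod>j\<in>J. ?g j (restrict z J j)) \<partial>torus_measure)"
    by (intro Bochner_Integration.integral_cong refl prod.cong) auto
  also have "\<dots> = (\<integral>z. (\<Prod>j\<in>J. ?g j (z j)) \<partial>distr torus_measure (PiM J (\<lambda>_. circle_measure)) (\<lambda>z. restrict z J))"
    unfolding torus_measure_def
    by (intro integral_distr[symmetric] measurable_restrict_subset borel_measurable_prod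
        measurable_circle_component) (auto simp: measurable_circle)
  also have "\<dots> = (\<integral>z. (\<Prod>j\<in>J. ?g j (z j)) \<partial>PiM J (\<lambda>_. circle_measure))"
    unfolding torus_measure_def by (subst torus.distr_PiM_restrict_finite[OF J]) auto
  also have "\<dots> = (\<Prod>j\<in>J. if kappa m j = kappa n j then 1 else 0)"
    by (subst torus.product_integral_prod[OF J int]) (simp add: integral_circle_power del: complex_cnj_power)
  also have "\<dots> = (if m = n then 1 else 0)"
  proof (cases "m = n")
    case False
    then obtain j where "kappa m j \<noteq> kappa n j" using kappa_inject assms by blast
    moreover from this have "j \<in> J" by (auto simp: J_def)
    ultimately show ?thesis using False J by auto
  qed auto
  finally show ?thesis .
qed

lemma monomial_measurable [measurable]:
  "monomial \<alpha> \<in> borel_measurable torus_measure"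
proof -
  have "(\<lambda>z. z j) \<in> borel_measurable torus_measure" for j
    unfolding torus_measure_def
    by (rule measurable_circle_component[where f = "\<lambda>z. z"]) auto
  then show ?thesis unfolding monomial_def
    by (intro borel_measurable_prod borel_measurable_power)
qed

section \<open>The Poisson extension along the flow\<close>

text \<open>The maximum principle in the upper half plane takes the place of the Poisson integral.
  The hypothesis bounds Re A on the real axis, the conclusion is its value at
  \<open>\<i> * t\<close>. Since only Re A is bounded by \<open>B\<close>, and only from above, the
  principle is applied to exp A, whose modulus is exp (Re A).\<close>

lemma halfplane_Re_bound:
  fixes c :: "'i \<Rightarrow> complex" and l :: "'i \<Rightarrow> real"
  assumes bound: "\<And>x. Re (\<Sum>i\<in>I. c i * cis (x * l i)) \<le> B" and "t \<ge> 0"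
  shows "Re (\<Sum>i\<in>I. c i * of_real (exp (- t * \<bar>l i\<bar>))) \<le> B"
proof -
  \<comment> \<open>Conjugating the terms of negative frequency leaves the real part on the real
    axis unchanged and turns every exponential into one of modulus at most 1 where Im z \<ge>
    0.\<close>
  define A where "A = (\<lambda>z. \<Sum>i\<in>I. if l i \<ge> 0 then c i * exp (\<i> * l i * z) else cnj (c i) * exp (- \<i> * l i * z))"
  define K where "K = (\<Sum>i\<in>I. cmod (c i))"
  have A_real: "Re (A (of_real x)) = Re (\<Sum>i\<in>I. c i * cis (x * l i))" for x
    unfolding A_def Re_sum by (intro sum.cong refl) (auto simp: cis_conv_exp exp_cnj mult_ac Re_exp Im_exp)
  have A_imag: "Re (A (\<i> * of_real t)) = Re (\<Sum>i\<in>I. c i * of_real (exp (- t * \<bar>l i\<bar>)))"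
    unfolding A_def Re_sum by (intro sum.cong refl) (auto simp: mult_ac Re_exp Im_exp exp_of_real[symmetric])
  have A_bound: "Re (A z) \<le> K" if "Im z \<ge> 0" for z
  proof -
    have "Re (A z) \<le> cmod (A z)" by (rule complex_Re_le_cmod)
    also have "\<dots> \<le> K" unfolding A_def K_def
      using that
      by (intro sum_norm_le)
         (auto simp: norm_mult mult_nonneg_nonneg mult_nonpos_nonneg intro!: mult_left_le)
    finally show ?thesis .
  qed
  have A_holo: "A holomorphic_on S" for S
    unfolding A_def
  proof (rule holomorphic_on_sum)
    fix i
    show "(\<lambda>z. if l i \<ge> 0 then c i * exp (\<i> * l i * z) else cnj (c i) * exp (- \<i> * l i * z)) holomorphic_on S"
      by (cases "l i \<ge> 0") (auto intro!: holomorphic_intros)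
  qed
  have main: "exp (Re (A (\<i> * of_real t))) \<le> exp B * (1 + \<epsilon> * t)" if "\<epsilon> > 0" for \<epsilon> :: real
  proof -
    \<comment> \<open>Phragmen-Lindelof: the denominator forces decay on the large half circle.\<close>
    define G where "G = (\<lambda>z. exp (A z) / (1 - \<i> * \<epsilon> * z))"
    \<comment> \<open>On the arc |exp A| \<le> exp K, while the denominator has modulus at least
      \<epsilon> R - 1, which this choice makes at least exp (K - B). The summand \<open>t\<close>
      puts \<open>\<i> * t\<close> into \<open>S\<close>.\<close>
    define R where "R = (1 + exp (K - B)) / \<epsilon> + t"
    define S where "S = cball 0 R \<inter> {z. Im z \<ge> 0}"
    have R: "R \<ge> t" "\<epsilon> * R \<ge> 1 + exp (K - B)"
      using that \<open>t \<ge> 0\<close> by (simp_all add: R_def field_simps add_nonneg_nonneg)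
    have den: "cmod (1 - \<i> * \<epsilon> * z) \<ge> 1" if "Im z \<ge> 0" for z
    proof -
      have "1 \<le> Re (1 - \<i> * \<epsilon> * z)" using that \<open>\<epsilon> > 0\<close> by simp
      then show ?thesis using complex_Re_le_cmod order_trans by blast
    qed
    have "cmod (G (\<i> * of_real t)) \<le> exp B"
    proof (rule maximum_modulus_frontier[where f = G and S = S])
      have "closed S" unfolding S_def by (intro closed_Int closed_cball closed_halfspace_Im_ge)
      have G: "G holomorphic_on S" unfolding G_def
      proof (rule holomorphic_on_divide)
        show "(\<lambda>z. exp (A z)) holomorphic_on S"
          using A_holo holomorphic_on_compose_gen[of A S exp UNIV] by (auto simp: o_def intro: holomorphic_intros)
        show "(\<lambda>z. 1 - \<i> * \<epsilon> * z) holomorphic_on S" by (intro holomorphic_intros)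
        fix z assume "z \<in> S"
        then show "1 - \<i> * \<epsilon> * z \<noteq> 0" using den[of z] by (auto simp: S_def simp del: eq_iff_diff_eq_0)
      qed
      then show "G holomorphic_on interior S" using holomorphic_on_subset interior_subset by blast
      show "continuous_on (closure S) G"
        using G \<open>closed S\<close> by (simp add: holomorphic_on_imp_continuous_on)
      show "bounded S" unfolding S_def using bounded_cball bounded_Int by blast
      show "\<i> * of_real t \<in> S" using \<open>t \<ge> 0\<close> R by (simp add: S_def norm_mult)
      fix z assume z: "z \<in> frontier S"
      then have "z \<in> S" using \<open>closed S\<close> frontier_subset_closed by blast
      have "z \<notin> ball 0 R \<inter> {z. Im z > 0}"
      proof
        assume "z \<in> ball 0 R \<inter> {z. Im z > 0}"
        moreover have "open (ball 0 R \<inter> {z. Im z > 0})"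
          by (intro open_Int open_ball open_halfspace_Im_gt)
        moreover have "ball 0 R \<inter> {z. Im z > 0} \<subseteq> S" by (auto simp: S_def)
        ultimately have "z \<in> interior S" using interior_maximal by blast
        then show False using z by (simp add: frontier_def)
      qed
      then consider "Im z = 0" | "cmod z = R" using \<open>z \<in> S\<close> by (auto simp: S_def less_le)
      then show "cmod (G z) \<le> exp B"
      proof cases
        case 1
        then have "z = of_real (Re z)" by (simp add: complex_eq_iff)
        then have "Re (A z) \<le> B" using A_real bound by metis
        then have "exp (Re (A z)) \<le> exp B * 1" by simp
        also have "\<dots> \<le> exp B * cmod (1 - \<i> * \<epsilon> * z)"
          using den 1 by (intro mult_left_mono) auto
        finally have "exp (Re (A z)) \<le> exp B * cmod (1 - \<i> * \<epsilon> * z)" .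
        moreover have "cmod (1 - \<i> * \<epsilon> * z) > 0"
          using den[of z] 1 by linarith
        ultimately show ?thesis
          by (simp only: G_def norm_divide norm_exp_eq_Re pos_divide_le_eq)
      next
        case 2
        have "exp (Re (A z)) \<le> exp K" using A_bound \<open>z \<in> S\<close> by (simp add: S_def)
        also have "\<dots> = exp B * exp (K - B)" by (simp flip: exp_add)
        also have "\<dots> \<le> exp B * (\<epsilon> * R - 1)" using R by (intro mult_left_mono) auto
        also have "\<epsilon> * R - 1 \<le> cmod (1 - \<i> * \<epsilon> * z)"
          using norm_triangle_ineq3[of 1 "\<i> * \<epsilon> * z"] \<open>\<epsilon> > 0\<close> 2 by (simp add: norm_mult)
        finally have "exp (Re (A z)) \<le> exp B * cmod (1 - \<i> * \<epsilon> * z)" by simp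
        then show ?thesis using den[of z] \<open>z \<in> S\<close>
          by (simp add: G_def norm_divide S_def divide_le_eq)
      qed
    qed
    moreover have "1 - \<i> * \<epsilon> * (\<i> * of_real t) = of_real (1 + \<epsilon> * t)" by (simp add: complex_eq_iff)
    moreover have "1 + \<epsilon> * t > 0" using \<open>\<epsilon> > 0\<close> \<open>t \<ge> 0\<close> by (simp add: add_pos_nonneg)
    ultimately show ?thesis by (simp add: G_def norm_divide divide_le_eq del: of_real_add of_real_mult)
  qed
  have "((\<lambda>\<epsilon>. exp B * (1 + \<epsilon> * t)) \<longlongrightarrow> exp B * (1 + 0 * t)) (at_right 0)"
    by (intro tendsto_intros)
  then have "exp (Re (A (\<i> * of_real t))) \<le> exp B * (1 + 0 * t)"
    by (rule tendsto_lowerbound) (use main in \<open>auto simp: eventually_at_right_less eventually_at_filter\<close>)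
  then show ?thesis using A_imag by simp
qed

text \<open>The modulus of \<open>w\<close> is the real part of \<open>s * w\<close> for the
  rotation \<open>s\<close>, and the rotated coefficients obey the same bound. Thus a modulus is
  estimated by the one-sided bound for real parts.\<close>

lemma poisson_bound:
  fixes c :: "'i \<Rightarrow> complex" and l :: "'i \<Rightarrow> real"
  assumes bound: "\<And>x. cmod (\<Sum>i\<in>I. c i * cis (x * l i)) \<le> B" and "t \<ge> 0"
  shows "cmod (\<Sum>i\<in>I. c i * of_real (exp (- t * \<bar>l i\<bar>))) \<le> B"
proof -
  define w where "w = (\<Sum>i\<in>I. c i * of_real (exp (- t * \<bar>l i\<bar>)))"
  define s where "s = cnj (sgn w)"
  have s: "cmod s \<le> 1" by (simp add: s_def norm_sgn)
  have "Re (\<Sum>i\<in>I. s * c i * of_real (exp (- t * \<bar>l i\<bar>))) \<le> B"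
  proof (rule halfplane_Re_bound)
    fix x
    have "Re (\<Sum>i\<in>I. s * c i * cis (x * l i)) \<le> cmod (\<Sum>i\<in>I. s * c i * cis (x * l i))"
      by (rule complex_Re_le_cmod)
    also have "\<dots> = cmod s * cmod (\<Sum>i\<in>I. c i * cis (x * l i))"
      by (simp add: sum_distrib_left mult.assoc flip: norm_mult)
    also have "\<dots> \<le> 1 * B" by (intro mult_mono s bound) auto
    finally show "Re (\<Sum>i\<in>I. s * c i * cis (x * l i)) \<le> B" by simp
  qed fact
  also have "(\<Sum>i\<in>I. s * c i * of_real (exp (- t * \<bar>l i\<bar>))) = s * w"
    by (simp add: w_def sum_distrib_left mult.assoc)
  also have "s * w = of_real (cmod w)"
  proof (cases "w = 0")
    case False
    have "s * w = (w * cnj w) / of_real (cmod w)"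
      by (simp add: s_def sgn_div_norm scaleR_conv_of_real divide_inverse mult_ac)
    then show ?thesis
      using False by (simp add: complex_norm_square[symmetric] power2_eq_square)
  qed simp
  finally show ?thesis by (simp add: w_def)
qed

section \<open>Frequencies and the Littlewood-Paley identity\<close>

text \<open>A class closed under sums, products and conjugation and contained in L^1 of the torus:
  integrability of a finite expression in characters can be read off from its shape.\<close>

definition bounded_measurable :: "((nat \<Rightarrow> complex) \<Rightarrow> complex) \<Rightarrow> bool" where
  "bounded_measurable X \<longleftrightarrow> X \<in> borel_measurable torus_measure \<and>
     (\<exists>B. \<forall>z\<in>space torus_measure. cmod (X z) \<le> B)"

lemma bounded_measurable_const: "bounded_measurable (\<lambda>z. c)"
  by (auto simp: bounded_measurable_def)

lemma bounded_measurable_monomial: "bounded_measurable (monomial \<alpha>)"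
  by (auto simp: bounded_measurable_def norm_monomial intro!: exI[of _ 1])

lemma bounded_measurable_cnj:
  "bounded_measurable X \<Longrightarrow> bounded_measurable (\<lambda>z. cnj (X z))"
  by (auto simp: bounded_measurable_def)

lemma bounded_measurable_add:
  assumes "bounded_measurable X" "bounded_measurable Y"
  shows "bounded_measurable (\<lambda>z. X z + Y z)"
proof -
  obtain B C where "\<forall>z\<in>space torus_measure. cmod (X z) \<le> B" "\<forall>z\<in>space torus_measure. cmod (Y z) \<le> C"
    using assms by (auto simp: bounded_measurable_def)
  then have "\<forall>z\<in>space torus_measure. cmod (X z + Y z) \<le> B + C"
    by (auto intro!: norm_triangle_mono)
  then show ?thesis using assms by (auto simp: bounded_measurable_def)
qed

lemma bounded_measurable_mult:
  assumes "bounded_measurable X" "bounded_measurable Y"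
  shows "bounded_measurable (\<lambda>z. X z * Y z)"
proof -
  obtain B C where "\<forall>z\<in>space torus_measure. cmod (X z) \<le> B" "\<forall>z\<in>space torus_measure. cmod (Y z) \<le> C"
    using assms by (auto simp: bounded_measurable_def)
  then have "\<forall>z\<in>space torus_measure. cmod (X z * Y z) \<le> B * C"
    by (auto simp: norm_mult intro!: mult_mono intro: order_trans[OF norm_ge_zero])
  then show ?thesis using assms by (auto simp: bounded_measurable_def)
qed

lemma bounded_measurable_sum:
  "(\<And>i. i \<in> I \<Longrightarrow> bounded_measurable (X i)) \<Longrightarrow> bounded_measurable (\<lambda>z. \<Sum>i\<in>I. X i z)"
  by (induction I rule: infinite_finite_induct)
     (auto intro: bounded_measurable_const bounded_measurable_add)

lemma bounded_measurable_if:
  "bounded_measurable X \<Longrightarrow> bounded_measurable Y \<Longrightarrow> bounded_measurable (\<lambda>z. if P then X z else Y z)"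
  by (cases P) auto

lemma bounded_measurable_diff:
  assumes "bounded_measurable X" "bounded_measurable Y"
  shows "bounded_measurable (\<lambda>z. X z - Y z)"
  using bounded_measurable_add[OF assms(1) bounded_measurable_mult[OF bounded_measurable_const[of "-1"] assms(2)]]
  by simp

lemmas bounded_measurable_intros =
  bounded_measurable_const bounded_measurable_monomial bounded_measurable_cnj bounded_measurable_add
  bounded_measurable_diff bounded_measurable_mult bounded_measurable_if bounded_measurable_sum

lemma bounded_measurable_integrable:
  assumes "bounded_measurable X" shows "integrable torus_measure X"
proof -
  interpret prob_space torus_measure by (rule prob_space_torus)
  show ?thesis using assms unfolding bounded_measurable_def
    by (auto intro!: integrable_const_bound)
qed

text \<open>
  Under the flow \<open>z\<^sub>j \<mapsto> z\<^sub>j p\<^sub>j\<^sup>i\<^sup>x\<close> these functions are multiplied by \<open>cis (x * l)\<close>.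
\<close>
definition eigenfunction :: "real \<Rightarrow> ((nat \<Rightarrow> complex) \<Rightarrow> complex) \<Rightarrow> bool" where
  "eigenfunction l X \<longleftrightarrow> (\<exists>c m n. m \<ge> 1 \<and> n \<ge> 1 \<and> l = ln (real m) - ln (real n) \<and>
     X = (\<lambda>z. c * chi m z * cnj (chi n z)))"

lemma eigenfunction_const: "eigenfunction 0 (\<lambda>z. c)"
  unfolding eigenfunction_def by (rule exI[of _ c], rule exI[of _ 1], rule exI[of _ 1]) (simp add: chi_1)

lemma eigenfunction_chi: "n \<ge> 1 \<Longrightarrow> eigenfunction (ln (real n)) (\<lambda>z. c * chi n z)"
  unfolding eigenfunction_def by (rule exI[of _ c], rule exI[of _ n], rule exI[of _ 1]) (simp add: chi_1)

lemma eigenfunction_cnj: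
  assumes "eigenfunction l X" shows "eigenfunction (- l) (\<lambda>z. cnj (X z))"
proof -
  obtain c m n where *: "m \<ge> 1" "n \<ge> 1" "l = ln (real m) - ln (real n)"
     "X = (\<lambda>z. c * chi m z * cnj (chi n z))"
    using assms by (auto simp: eigenfunction_def)
  show ?thesis unfolding eigenfunction_def
    by (rule exI[of _ "cnj c"], rule exI[of _ n], rule exI[of _ m]) (use * in \<open>simp add: mult_ac\<close>)
qed

lemma eigenfunction_mult:
  assumes "eigenfunction l X" "eigenfunction k Y"
  shows "eigenfunction (l + k) (\<lambda>z. X z * Y z)"
proof -
  obtain c m n where *: "m \<ge> 1" "n \<ge> 1" "l = ln (real m) - ln (real n)"
     "X = (\<lambda>z. c * chi m z * cnj (chi n z))"
    using assms by (auto simp: eigenfunction_def)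
  obtain c' m' n' where **: "m' \<ge> 1" "n' \<ge> 1" "k = ln (real m') - ln (real n')"
     "Y = (\<lambda>z. c' * chi m' z * cnj (chi n' z))"
    using assms by (auto simp: eigenfunction_def)
  show ?thesis unfolding eigenfunction_def
    by (rule exI[of _ "c * c'"], rule exI[of _ "m * m'"], rule exI[of _ "n * n'"])
       (use * ** in \<open>simp add: chi_mult ln_mult mult_ac Suc_le_eq\<close>)
qed

lemma eigenfunction_bounded_measurable: "eigenfunction l X \<Longrightarrow> bounded_measurable X"
  by (auto simp: eigenfunction_def intro!: bounded_measurable_intros)

lemma eigenfunction_flow:
  assumes "eigenfunction l X"
    "\<And>n. n \<ge> 1 \<Longrightarrow> chi n w = chi n z * cis (x * ln (real n))"
  shows "X w = X z * cis (x * l)"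
proof -
  obtain c m n where *: "m \<ge> 1" "n \<ge> 1" "l = ln (real m) - ln (real n)"
     "X = (\<lambda>z. c * chi m z * cnj (chi n z))"
    using assms by (auto simp: eigenfunction_def)
  have "cis (x * l) = cis (x * ln (real m)) * cnj (cis (x * ln (real n)))"
    by (simp add: cis_cnj cis_mult * algebra_simps)
  then show ?thesis by (simp add: *(3,4) assms(2)[OF *(1)] assms(2)[OF *(2)] mult_ac)
qed

text \<open>Up to a constant the integrand is \<open>chi (m * n') z * cnj (chi (n * m') z)\<close>.
  Its integral can be nonzero only if m n' = n m', and taking logarithms this equality would make
  the two frequencies equal.\<close>

lemma eigenfunction_orthogonal:
  assumes "eigenfunction l X" "eigenfunction k Y" "l \<noteq> k"
  shows "(\<integral>z. X z * cnj (Y z) \<partial>torus_measure) = 0"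
proof -
  obtain c m n where *: "m \<ge> 1" "n \<ge> 1" "l = ln (real m) - ln (real n)"
     "X = (\<lambda>z. c * chi m z * cnj (chi n z))"
    using assms by (auto simp: eigenfunction_def)
  obtain c' m' n' where **: "m' \<ge> 1" "n' \<ge> 1" "k = ln (real m') - ln (real n')"
     "Y = (\<lambda>z. c' * chi m' z * cnj (chi n' z))"
    using assms by (auto simp: eigenfunction_def)
  have "m * n' \<noteq> n * m'"
  proof
    assume "m * n' = n * m'"
    then have "ln (real m * real n') = ln (real n * real m')" by (metis of_nat_mult)
    then show False using * ** assms(3) by (simp add: ln_mult)
  qed
  have "(\<integral>z. X z * cnj (Y z) \<partial>torus_measure) =
     (\<integral>z. (c * cnj c') * (chi (m * n') z * cnj (chi (n * m') z)) \<partial>torus_measure)"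
    using * ** by (simp add: chi_mult mult_ac)
  also have "\<dots> = (c * cnj c') * (\<integral>z. chi (m * n') z * cnj (chi (n * m') z) \<partial>torus_measure)"
    by simp
  also have "\<dots> = 0" using * ** \<open>m * n' \<noteq> n * m'\<close>
    by (subst integral_chi) (auto simp: Suc_le_eq)
  finally show ?thesis .
qed

text \<open>A function that is analytic along the flow, kept as an indexed list of its terms.
  Frequencies may repeat, so a product is again such a family, indexed by pairs, without collecting
  terms.\<close>

definition analytic_family :: "'i set \<Rightarrow> ('i \<Rightarrow> real) \<Rightarrow> ('i \<Rightarrow> (nat \<Rightarrow> complex) \<Rightarrow> complex) \<Rightarrow> bool" where
  "analytic_family I l X \<longleftrightarrow> finite I \<and> (\<forall>i\<in>I. l i \<ge> 0 \<and> eigenfunction (l i) (X i))"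

text \<open>With frequencies ln n this is the horizontal translate f(s + t) of a Dirichlet
  polynomial, the continuation of the flow to imaginary time.\<close>

definition translate :: "'i set \<Rightarrow> ('i \<Rightarrow> real) \<Rightarrow> ('i \<Rightarrow> (nat \<Rightarrow> complex) \<Rightarrow> complex) \<Rightarrow> real \<Rightarrow> (nat \<Rightarrow> complex) \<Rightarrow> complex" where
  "translate I l X t z = (\<Sum>i\<in>I. of_real (exp (- t * l i)) * X i z)"

text \<open>\<open>slope\<close> is minus the derivative of \<open>translate\<close> with respect to \<open>t\<close>.\<close>
definition slope :: "'i set \<Rightarrow> ('i \<Rightarrow> real) \<Rightarrow> ('i \<Rightarrow> (nat \<Rightarrow> complex) \<Rightarrow> complex) \<Rightarrow> real \<Rightarrow> (nat \<Rightarrow> complex) \<Rightarrow> complex" where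
  "slope I l X t z = (\<Sum>i\<in>I. l i * of_real (exp (- t * l i)) * X i z)"

text \<open>For an analytic family this is the limit of \<open>translate\<close> as t tends to
  infinity, and so the boundary term at infinity in the Littlewood-Paley identity.\<close>

definition stationary :: "'i set \<Rightarrow> ('i \<Rightarrow> real) \<Rightarrow> ('i \<Rightarrow> (nat \<Rightarrow> complex) \<Rightarrow> complex) \<Rightarrow> (nat \<Rightarrow> complex) \<Rightarrow> complex" where
  "stationary I l X z = (\<Sum>i\<in>I. if l i = 0 then X i z else 0)"

definition freq_prod :: "('i \<Rightarrow> real) \<Rightarrow> ('j \<Rightarrow> real) \<Rightarrow> 'i \<times> 'j \<Rightarrow> real" where
  "freq_prod l k = (\<lambda>(i, j). l i + k j)"

definition fun_prod :: "('i \<Rightarrow> (nat \<Rightarrow> complex) \<Rightarrow> complex) \<Rightarrow> ('j \<Rightarrow> (nat \<Rightarrow> complex) \<Rightarrow> complex)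
    \<Rightarrow> 'i \<times> 'j \<Rightarrow> (nat \<Rightarrow> complex) \<Rightarrow> complex" where
  "fun_prod X Y = (\<lambda>(i, j) z. X i z * Y j z)"

lemma analytic_family_prod:
  "analytic_family I l X \<Longrightarrow> analytic_family J k Y \<Longrightarrow>
    analytic_family (I \<times> J) (freq_prod l k) (fun_prod X Y)"
  by (auto simp: analytic_family_def freq_prod_def fun_prod_def intro: eigenfunction_mult)

lemma of_real_exp_split:
  "complex_of_real (exp (- t * (a + b))) = of_real (exp (- t * a)) * of_real (exp (- t * b))"
  by (simp add: distrib_left exp_add exp_diff exp_minus field_simps)

lemma translate_prod:
  "translate (I \<times> J) (freq_prod l k) (fun_prod X Y) t z = translate I l X t z * translate J k Y t z"
  unfolding translate_def sum_product sum.cartesian_product freq_prod_def fun_prod_def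
  by (intro sum.cong refl) (auto simp only: of_real_exp_split mult_ac split: prod.splits)

lemma slope_prod:
  "slope (I \<times> J) (freq_prod l k) (fun_prod X Y) t z =
     slope I l X t z * translate J k Y t z + translate I l X t z * slope J k Y t z"
  unfolding translate_def slope_def sum_product sum.cartesian_product freq_prod_def fun_prod_def sum.distrib[symmetric]
  by (intro sum.cong refl)
     (clarsimp simp only: of_real_exp_split of_real_add split_conv, simp add: algebra_simps)

text \<open>The sum of two nonnegative frequencies is 0 only if both are.\<close>

lemma stationary_prod:
  assumes "analytic_family I l X" "analytic_family J k Y"
  shows "stationary (I \<times> J) (freq_prod l k) (fun_prod X Y) z = stationary I l X z * stationary J k Y z"
  unfolding stationary_def sum_product sum.cartesian_product freq_prod_def fun_prod_def
  using assms by (intro sum.cong refl) (auto simp: analytic_family_def add_nonneg_eq_0_iff)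

lemma analytic_family_bounded_measurable:
  assumes "analytic_family I l X"
  shows "bounded_measurable (translate I l X t)" "bounded_measurable (slope I l X t)"
    "bounded_measurable (stationary I l X)"
proof -
  have X: "bounded_measurable (X i)" if "i \<in> I" for i
    using assms that by (auto simp: analytic_family_def intro: eigenfunction_bounded_measurable)
  show "bounded_measurable (translate I l X t)" "bounded_measurable (slope I l X t)"
    "bounded_measurable (stationary I l X)"
    unfolding translate_def slope_def stationary_def
    using X by (auto intro!: bounded_measurable_intros)
qed

definition re_inner :: "((nat \<Rightarrow> complex) \<Rightarrow> complex) \<Rightarrow> ((nat \<Rightarrow> complex) \<Rightarrow> complex) \<Rightarrow> real" where
  "re_inner X Y = Re (\<integral>z. X z * cnj (Y z) \<partial>torus_measure)"

lemma integral_sum_product: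
  assumes "finite I" "finite J" "\<And>i. i \<in> I \<Longrightarrow> bounded_measurable (X i)" "\<And>j. j \<in> J \<Longrightarrow> bounded_measurable (Y j)"
  shows "(\<integral>z. (\<Sum>i\<in>I. a i * X i z) * cnj (\<Sum>j\<in>J. b j * Y j z) \<partial>torus_measure) =
    (\<Sum>i\<in>I. \<Sum>j\<in>J. a i * cnj (b j) * (\<integral>z. X i z * cnj (Y j z) \<partial>torus_measure))"
proof -
  have int: "integrable torus_measure (\<lambda>z. a i * cnj (b j) * (X i z * cnj (Y j z)))"
    if "i \<in> I" "j \<in> J" for i j
    using that assms by (intro bounded_measurable_integrable bounded_measurable_intros)
  have "(\<integral>z. (\<Sum>i\<in>I. a i * X i z) * cnj (\<Sum>j\<in>J. b j * Y j z) \<partial>torus_measure) =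
      (\<integral>z. (\<Sum>i\<in>I. \<Sum>j\<in>J. a i * cnj (b j) * (X i z * cnj (Y j z))) \<partial>torus_measure)"
    by (intro Bochner_Integration.integral_cong refl)
       (simp only: cnj_sum sum_product complex_cnj_mult mult_ac)
  also have "\<dots> = (\<Sum>i\<in>I. \<Sum>j\<in>J. \<integral>z. a i * cnj (b j) * (X i z * cnj (Y j z)) \<partial>torus_measure)"
  proof (subst Bochner_Integration.integral_sum)
    show "integrable torus_measure (\<lambda>z. \<Sum>j\<in>J. a i * cnj (b j) * (X i z * cnj (Y j z)))" if "i \<in> I" for i
      using int that by (intro Bochner_Integration.integrable_sum)
  qed (intro sum.cong refl Bochner_Integration.integral_sum int)
  finally show ?thesis by simp
qed

text \<open>The integral of t exp (-2 l t) over t \<ge> 0 is 1 / (4 l^2), so the weight 4 t makes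
  the value independent of \<open>l\<close>. \<open>?F\<close> is the antiderivative that vanishes
  at infinity.\<close>

lemma has_integral_weight:
  fixes l :: real assumes "l > 0"
  shows "((\<lambda>t. 4 * t * (l * l * exp (- t * (l + l)))) has_integral 1) {0..}"
proof -
  let ?f = "\<lambda>t. 4 * t * (l * l * exp (- t * (l + l)))"
  let ?F = "\<lambda>t. - (2 * l * t + 1) * exp (- t * (l + l))"
  have "(\<integral>\<^sup>+t. ennreal (?f t) * indicator {0..} t \<partial>lborel) = ennreal (0 - ?F 0)"
  proof (rule nn_integral_FTC_atLeast)
    show "(?F \<longlongrightarrow> 0) at_top" using assms by real_asymp
  qed (use assms in \<open>auto intro!: derivative_eq_intros simp: algebra_simps power2_eq_square\<close>)
  also have "(\<integral>\<^sup>+t. ennreal (?f t) * indicator {0..} t \<partial>lborel) = (\<integral>\<^sup>+t. ennreal (if t \<in> {0..} then ?f t else 0) \<partial>lborel)"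
    by (intro nn_integral_cong) (auto split: split_indicator)
  finally have "(\<integral>\<^sup>+t. ennreal (if t \<in> {0..} then ?f t else 0) \<partial>lborel) = ennreal 1" by simp
  then have "((\<lambda>t. if t \<in> {0..} then ?f t else 0) has_integral 1) UNIV"
    by (intro nn_integral_has_integral) (use assms in auto)
  then show ?thesis by (simp only: has_integral_restrict_UNIV)
qed

text \<open>Both sides are bilinear, so it suffices to compare them on pairs of eigenfunctions.
  Different frequencies are orthogonal. A common positive frequency contributes its inner product
  times the integral 1 of \<open>has_integral_weight\<close>. The frequency 0 has slope 0, and the
  stationary parts remove it on the right.\<close>

lemma littlewood_paley:
  assumes I: "analytic_family I l X" and J: "analytic_family J k Y"
  shows "((\<lambda>t. 4 * t * re_inner (slope I l X t) (slope J k Y t)) has_integral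
     re_inner (translate I l X 0) (translate J k Y 0) - re_inner (stationary I l X) (stationary J k Y)) {0..}"
proof -
  define C where "C = (\<lambda>i j. Re (\<integral>z. X i z * cnj (Y j z) \<partial>torus_measure))"
  have fin: "finite I" "finite J" using I J by (auto simp: analytic_family_def)
  have bm: "\<And>i. i \<in> I \<Longrightarrow> bounded_measurable (X i)" "\<And>j. j \<in> J \<Longrightarrow> bounded_measurable (Y j)"
    using I J by (auto simp: analytic_family_def intro: eigenfunction_bounded_measurable)
  have expand: "re_inner (\<lambda>z. \<Sum>i\<in>I. complex_of_real (a i) * X i z) (\<lambda>z. \<Sum>j\<in>J. complex_of_real (b j) * Y j z) =
      (\<Sum>i\<in>I. \<Sum>j\<in>J. a i * b j * C i j)" for a b
    unfolding re_inner_def C_def by (subst integral_sum_product[OF fin bm]) auto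
  have slope: "re_inner (slope I l X t) (slope J k Y t) =
      (\<Sum>i\<in>I. \<Sum>j\<in>J. (l i * exp (- t * l i)) * (k j * exp (- t * k j)) * C i j)" for t
    using expand[of "\<lambda>i. l i * exp (- t * l i)" "\<lambda>j. k j * exp (- t * k j)"]
    by (simp only: slope_def[abs_def] of_real_mult)
  have transl: "re_inner (translate I l X 0) (translate J k Y 0) = (\<Sum>i\<in>I. \<Sum>j\<in>J. C i j)"
    using expand[of "\<lambda>i. 1" "\<lambda>j. 1"] by (simp add: translate_def[abs_def])
  have stat: "re_inner (stationary I l X) (stationary J k Y) =
      (\<Sum>i\<in>I. \<Sum>j\<in>J. (if l i = 0 then 1 else 0) * (if k j = 0 then 1 else 0) * C i j)"
  proof -
    have "stationary I l X = (\<lambda>z. \<Sum>i\<in>I. complex_of_real (if l i = 0 then 1 else 0) * X i z)"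
      "stationary J k Y = (\<lambda>z. \<Sum>j\<in>J. complex_of_real (if k j = 0 then 1 else 0) * Y j z)"
      by (auto simp: stationary_def fun_eq_iff intro!: sum.cong)
    then show ?thesis by (simp only: expand)
  qed
  have "((\<lambda>t. 4 * t * ((l i * exp (- t * l i)) * (k j * exp (- t * k j)) * C i j)) has_integral
       C i j - (if l i = 0 then 1 else 0) * (if k j = 0 then 1 else 0) * C i j) {0..}"
    if "i \<in> I" "j \<in> J" for i j
  proof (cases "l i = k j")
    case False
    then have "C i j = 0"
      using I J that eigenfunction_orthogonal[of "l i" "X i" "k j" "Y j"]
      by (auto simp: analytic_family_def C_def)
    then show ?thesis by simp
  next
    case True
    show ?thesis
    proof (cases "l i = 0")
      case False
      then have "l i > 0" using I that by (auto simp: analytic_family_def less_le)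
      have "exp (- t * (l i + l i)) = exp (- t * l i) * exp (- t * l i)" for t
        by (simp add: exp_add[symmetric])
      with has_integral_mult_left[OF has_integral_weight[OF \<open>l i > 0\<close>], of "C i j"]
      show ?thesis using True False by (simp only: mult_ac) simp
    qed (use True in auto)
  qed
  then have "((\<lambda>t. \<Sum>i\<in>I. \<Sum>j\<in>J. 4 * t * ((l i * exp (- t * l i)) * (k j * exp (- t * k j)) * C i j)) has_integral
      (\<Sum>i\<in>I. \<Sum>j\<in>J. C i j - (if l i = 0 then 1 else 0) * (if k j = 0 then 1 else 0) * C i j)) {0..}"
    by (intro has_integral_sum fin)
  then show ?thesis
    unfolding slope transl stat by (simp only: sum_distrib_left sum_subtractf)
qed

section \<open>The bilinear estimate\<close>

lemma re_inner_eq: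
  assumes "bounded_measurable X" "bounded_measurable Y"
  shows "re_inner X Y = (\<integral>z. Re (X z * cnj (Y z)) \<partial>torus_measure)"
  unfolding re_inner_def
  by (intro integral_Re[symmetric] bounded_measurable_integrable bounded_measurable_intros assms)

lemma integrable_Re_inner:
  assumes "bounded_measurable X" "bounded_measurable Y"
  shows "integrable torus_measure (\<lambda>z. Re (X z * cnj (Y z)))"
  by (intro integrable_Re bounded_measurable_integrable bounded_measurable_intros assms)

lemma re_inner_nonneg: "bounded_measurable X \<Longrightarrow> re_inner X X \<ge> 0"
  by (subst re_inner_eq) (auto intro!: Bochner_Integration.integral_nonneg)

text \<open>
  The Laplacian of \<open>\<bar>u f\<bar>\<^sup>2\<close>, where \<open>u = a + cnj b\<close> is harmonic and \<open>f\<close> is analytic, expressed in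
  two ways.
\<close>
lemma laplacian_identity:
  fixes a b f a' b' f' :: complex
  defines "u \<equiv> a + cnj b"
  shows "Re ((a' * f + a * f') * cnj (a' * f + a * f')) +
      2 * Re (((a' * f + a * f') * b + a * f * b') * cnj f') +
      Re ((b' * f + b * f') * cnj (b' * f + b * f')) =
    (cmod (a' * f + u * f'))\<^sup>2 + (cmod (b' * f))\<^sup>2 + 2 * Re (cnj u * cnj (b' * f) * f')"
  unfolding u_def cmod_power2 by (simp add: algebra_simps power2_eq_square)

text \<open>In the second form of \<open>laplacian_identity\<close> the mixed term is at least -|b'
  f|^2 - |f'|^2 because |u| \<le> 1. The terms |b' f|^2 cancel and leave the lower bound |a' f + u
  f'|^2 - |f'|^2; it remains to square |a' f| \<le> |a' f + u f'| + |f'|.\<close>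

lemma laplacian_lower_bound:
  fixes a b f a' b' f' :: complex
  assumes "cmod (a + cnj b) \<le> 1"
  shows "(cmod (a' * f))\<^sup>2 \<le>
    2 * (Re ((a' * f + a * f') * cnj (a' * f + a * f')) +
      2 * Re (((a' * f + a * f') * b + a * f * b') * cnj f') +
      Re ((b' * f + b * f') * cnj (b' * f + b * f'))) + 4 * (cmod f')\<^sup>2"
proof -
  define u where "u = a + cnj b"
  have u: "cmod u \<le> 1" using assms by (simp add: u_def)
  have "- Re (cnj u * cnj (b' * f) * f') \<le> cmod (cnj u * cnj (b' * f) * f')"
    using abs_Re_le_cmod[of "cnj u * cnj (b' * f) * f'"] by linarith
  also have "\<dots> = cmod u * (cmod (b' * f) * cmod f')" by (simp add: norm_mult)
  also have "\<dots> \<le> 1 * (cmod (b' * f) * cmod f')" by (intro mult_right_mono u) auto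
  finally have 1: "- 2 * Re (cnj u * cnj (b' * f) * f') \<le> (cmod (b' * f))\<^sup>2 + (cmod f')\<^sup>2"
    using sum_squares_bound[of "cmod (b' * f)" "cmod f'"] by linarith
  have "cmod (a' * f) \<le> cmod (a' * f + u * f') + cmod (u * f')"
    using norm_triangle_ineq4[of "a' * f + u * f'" "u * f'"] by simp
  also have "cmod (u * f') \<le> cmod f'" using u by (simp add: norm_mult mult_left_le_one_le)
  finally have "cmod (a' * f) \<le> cmod (a' * f + u * f') + cmod f'" by simp
  then have "(cmod (a' * f))\<^sup>2 \<le> (cmod (a' * f + u * f') + cmod f')\<^sup>2" by (rule power_mono) simp
  also have "\<dots> \<le> 2 * (cmod (a' * f + u * f'))\<^sup>2 + 2 * (cmod f')\<^sup>2"
    using sum_squares_bound[of "cmod (a' * f + u * f')" "cmod f'"] by (simp add: power2_sum)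
  finally have 2: "(cmod (a' * f))\<^sup>2 \<le> 2 * (cmod (a' * f + u * f'))\<^sup>2 + 2 * (cmod f')\<^sup>2" .
  have "x \<le> 2 * (p + 2 * q + s) + 4 * w"
    if "x \<le> 2 * v + 2 * w" "- 2 * r \<le> t + w" "p + 2 * q + s = v + t + 2 * r"
    for x p q s v w r t :: real using that by argo
  from this[OF 2 1 laplacian_identity[of a' f a f' b b', folded u_def]] show ?thesis .
qed

lemma Re_mult_cnj_self: "Re (z * cnj z) = (cmod z)\<^sup>2"
  by (simp add: complex_norm_square[symmetric])

text \<open>Pointwise 2 |f g' a'| \<le> |g'|^2 + |a' f|^2, and half of
  \<open>laplacian_lower_bound\<close> controls half of the last term. \<open>P\<close>,
  \<open>R\<close> and \<open>S\<close> are the derivatives of a f, a f b and b f by the product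
  rule, which is the shape that the Littlewood-Paley identity integrates.\<close>

lemma re_inner_estimate:
  assumes bm: "bounded_measurable a" "bounded_measurable b" "bounded_measurable f" "bounded_measurable a'"
    "bounded_measurable b'" "bounded_measurable f'" "bounded_measurable g'"
    and u: "\<And>z. z \<in> space torus_measure \<Longrightarrow> cmod (a z + cnj (b z)) \<le> 1"
  defines "P \<equiv> \<lambda>z. a' z * f z + a z * f' z"
  defines "R \<equiv> \<lambda>z. P z * b z + a z * f z * b' z"
  defines "S \<equiv> \<lambda>z. b' z * f z + b z * f' z"
  shows "re_inner (\<lambda>z. f z * g' z) a' \<le>
    1/2 * re_inner g' g' + (re_inner P P + 2 * re_inner R f' + re_inner S S) + 2 * re_inner f' f'"
proof -
  have bm': "bounded_measurable P" "bounded_measurable R" "bounded_measurable S"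
     "bounded_measurable (\<lambda>z. f z * g' z)"
    unfolding P_def R_def S_def by (intro bounded_measurable_intros bm)+
  note int = integrable_Re_inner[OF bm'(4) bm(4)] integrable_Re_inner[OF bm(7,7)]
    integrable_Re_inner[OF bm'(1,1)] integrable_Re_inner[OF bm'(2) bm(6)]
    integrable_Re_inner[OF bm'(3,3)] integrable_Re_inner[OF bm(6,6)]
  note eqs = re_inner_eq[OF bm'(4) bm(4)] re_inner_eq[OF bm(7,7)] re_inner_eq[OF bm'(1,1)]
    re_inner_eq[OF bm'(2) bm(6)] re_inner_eq[OF bm'(3,3)] re_inner_eq[OF bm(6,6)]
  have "(\<integral>z. Re (f z * g' z * cnj (a' z)) \<partial>torus_measure) \<le>
    (\<integral>z. 1/2 * Re (g' z * cnj (g' z)) + (Re (P z * cnj (P z)) + 2 * Re (R z * cnj (f' z)) + Re (S z * cnj (S z)))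
       + 2 * Re (f' z * cnj (f' z)) \<partial>torus_measure)"
  proof (rule integral_mono)
    fix z assume z: "z \<in> space torus_measure"
    have "Re (f z * g' z * cnj (a' z)) \<le> cmod (f z * g' z * cnj (a' z))" by (rule complex_Re_le_cmod)
    also have "\<dots> = cmod (g' z) * cmod (a' z * f z)" by (simp add: norm_mult)
    finally have "2 * Re (f z * g' z * cnj (a' z)) \<le> (cmod (g' z))\<^sup>2 + (cmod (a' z * f z))\<^sup>2"
      using sum_squares_bound[of "cmod (g' z)" "cmod (a' z * f z)"] by linarith
    moreover have "x \<le> 1/2 * y + (p + 2 * q + s) + 2 * w"
      if "2 * x \<le> y + v" "v \<le> 2 * (p + 2 * q + s) + 4 * w" for x y p q s v w :: real
      using that by argo
    ultimately show "Re (f z * g' z * cnj (a' z)) \<le> 1/2 * Re (g' z * cnj (g' z)) +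
      (Re (P z * cnj (P z)) + 2 * Re (R z * cnj (f' z)) + Re (S z * cnj (S z)))
       + 2 * Re (f' z * cnj (f' z))"
      using laplacian_lower_bound[OF u[OF z], of "a' z" "f z" "f' z" "b' z"]
      unfolding P_def R_def S_def Re_mult_cnj_self[of "g' z"] Re_mult_cnj_self[of "f' z"] by blast
  qed (intro Bochner_Integration.integrable_add integrable_mult_right int)+
  also have "\<dots> = 1/2 * re_inner g' g' + (re_inner P P + 2 * re_inner R f' + re_inner S S) + 2 * re_inner f' f'"
    unfolding eqs by (simp only: Bochner_Integration.integral_add Bochner_Integration.integrable_add
        integrable_mult_right integral_mult_right_zero int)
  finally show ?thesis unfolding eqs .
qed

text \<open>The left side is the integral of 4 t times the pairing of f g' with a', and
  \<open>re_inner_estimate\<close> applies at each t. After integration g' and f' give at most 1/2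
  and 2 times the squared norms of g and f; the Laplacian gives at most the mean of |u f|^2 at t =
  0, hence one more squared norm of f.\<close>

lemma bilinear_estimate:
  assumes f: "analytic_family I l X" and g: "analytic_family J k Y"
    and P: "finite P" "\<And>p. p \<in> P \<Longrightarrow> eigenfunction (m p) (H p)"
    and bound: "\<And>z. z \<in> space torus_measure \<Longrightarrow> cmod (\<Sum>p\<in>P. H p z) \<le> 1"
  shows "re_inner (\<lambda>z. \<Sum>(i, j)\<in>I \<times> J. of_real (k j / (l i + k j)) * (X i z * Y j z)) (\<lambda>z. \<Sum>p\<in>P. H p z) \<le>
    1/2 * re_inner (translate J k Y 0) (translate J k Y 0) +
    3 * re_inner (translate I l X 0) (translate I l X 0)"
proof -
  \<comment> \<open>Division by the total frequency is integration, and the factor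
    \<open>k j\<close> is the derivative of g. If both frequencies are 0 the coefficient is 0 / 0 =
    0, so this primitive has no stationary part.\<close>
  define F where "F = (\<lambda>(i, j) z. of_real (k j / (l i + k j)) * (X i z * Y j z))"
  define lF where "lF = freq_prod l k"
  define A where "A = {p\<in>P. m p \<ge> 0}"
  \<comment> \<open>Frequency 0 goes to \<open>A\<close> alone, so b has only positive frequencies.
    Its stationary part vanishes, and with it that of a f b, whose contribution would otherwise have
    no sign.\<close>
  define B where "B = {p\<in>P. m p < 0}"
  define HB where "HB = (\<lambda>p z. cnj (H p z))"
  let ?mB = "\<lambda>p. - m p"
  have fam_F: "analytic_family (I \<times> J) lF F"
  proof -
    have "eigenfunction (l i + k j) (F (i, j))" if "i \<in> I" "j \<in> J" for i j
    proof -
      have "eigenfunction (0 + (l i + k j)) (\<lambda>z. of_real (k j / (l i + k j)) * (X i z * Y j z))"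
        by (intro eigenfunction_mult eigenfunction_const)
           (use f g that in \<open>auto simp: analytic_family_def\<close>)
      then show ?thesis by (simp only: F_def split_conv add_0_left)
    qed
    then show ?thesis using f g by (auto simp: analytic_family_def lF_def freq_prod_def)
  qed
  have fam_A: "analytic_family A m H" and fam_B: "analytic_family B ?mB HB"
    using P by (auto simp: analytic_family_def A_def B_def HB_def intro: eigenfunction_cnj)
  define a b f g where "a = translate A m H" and "b = translate B ?mB HB"
    and "f = translate I l X" and "g = translate J k Y"
  define a' b' f' g' where "a' = slope A m H" and "b' = slope B ?mB HB"
    and "f' = slope I l X" and "g' = slope J k Y"
  have fam_af: "analytic_family (A \<times> I) (freq_prod m l) (fun_prod H X)"
    by (rule analytic_family_prod[OF fam_A assms(1)])
  have fam_afb: "analytic_family ((A \<times> I) \<times> B) (freq_prod (freq_prod m l) ?mB) (fun_prod (fun_prod H X) HB)"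
    by (rule analytic_family_prod[OF fam_af fam_B])
  have fam_bf: "analytic_family (B \<times> I) (freq_prod ?mB l) (fun_prod HB X)"
    by (rule analytic_family_prod[OF fam_B assms(1)])
  note bm = analytic_family_bounded_measurable[OF fam_A] analytic_family_bounded_measurable[OF fam_B]
    analytic_family_bounded_measurable[OF assms(1)] analytic_family_bounded_measurable[OF assms(2)]
  have u: "cmod (a t z + cnj (b t z)) \<le> 1" if "t \<ge> 0" "z \<in> space torus_measure" for t z
  proof -
    have "P = A \<union> B" "A \<inter> B = {}" "finite A" "finite B" using P by (auto simp: A_def B_def)
    from sum.union_disjoint[OF this(3,4,2), of "\<lambda>p. H p z * of_real (exp (- t * \<bar>m p\<bar>))", folded this(1)]
    have "(\<Sum>p\<in>P. H p z * of_real (exp (- t * \<bar>m p\<bar>))) =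
        (\<Sum>p\<in>A. H p z * of_real (exp (- t * \<bar>m p\<bar>))) + (\<Sum>p\<in>B. H p z * of_real (exp (- t * \<bar>m p\<bar>)))" .
    also have "(\<Sum>p\<in>A. H p z * of_real (exp (- t * \<bar>m p\<bar>))) = a t z"
      unfolding a_def translate_def by (intro sum.cong) (auto simp: A_def)
    also have "(\<Sum>p\<in>B. H p z * of_real (exp (- t * \<bar>m p\<bar>))) = cnj (b t z)"
      unfolding b_def translate_def cnj_sum by (intro sum.cong) (auto simp: B_def HB_def)
    finally have "(\<Sum>p\<in>P. H p z * of_real (exp (- t * \<bar>m p\<bar>))) = a t z + cnj (b t z)" .
    moreover have "cmod (\<Sum>p\<in>P. H p z * of_real (exp (- t * \<bar>m p\<bar>))) \<le> 1"
    \<comment> \<open>For fixed \<open>z\<close> the test function along the orbit of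
      \<open>z\<close> is a trigonometric polynomial in \<open>x\<close> with coefficients
      \<open>H p z\<close>. It is bounded by 1 because the orbit stays in the torus.\<close>
    proof (rule poisson_bound)
      fix x
      obtain w where "w \<in> space torus_measure"
        "\<And>n. n \<ge> 1 \<Longrightarrow> chi n w = chi n z * cis (x * ln (real n))"
        using torus_flow[OF \<open>z \<in> space torus_measure\<close>] by blast
      then show "cmod (\<Sum>p\<in>P. H p z * cis (x * m p)) \<le> 1"
        using bound[of w] eigenfunction_flow[OF P(2)] by simp
    qed fact
    ultimately show ?thesis by simp
  qed
  have slope_F: "slope (I \<times> J) lF F t = (\<lambda>z. f t z * g' t z)" for t
  proof
    fix z
    have "complex_of_real (lF p) * complex_of_real (exp (- t * lF p)) * F p z =
        (case p of (i, j) \<Rightarrow> (of_real (exp (- t * l i)) * X i z) * (of_real (k j) * of_real (exp (- t * k j)) * Y j z))"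
      if p: "p \<in> I \<times> J" for p
    proof -
      obtain i j where ij: "p = (i, j)" "i \<in> I" "j \<in> J" using p by auto
      have "l i \<ge> 0" "k j \<ge> 0" using assms ij by (auto simp: analytic_family_def)
      \<comment> \<open>This includes the case of total frequency 0, where nonnegativity forces
        \<open>k j = 0\<close>.\<close>
      then have "(l i + k j) * (k j / (l i + k j)) = k j" by auto
      then have "complex_of_real (l i + k j) * of_real (k j / (l i + k j)) = of_real (k j)"
        by (metis of_real_mult)
      then have "of_real (k j) * (of_real (exp (- t * l i)) * of_real (exp (- t * k j)) * (X i z * Y j z)) =
         complex_of_real (l i + k j) * of_real (k j / (l i + k j)) * (of_real (exp (- t * (l i + k j))) * (X i z * Y j z))"
        by (simp only: of_real_exp_split)
      then show ?thesis
        by (simp only: ij lF_def freq_prod_def F_def split_conv mult_ac)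
    qed
    then show "slope (I \<times> J) lF F t z = f t z * g' t z"
      unfolding slope_def f_def g'_def translate_def sum_product sum.cartesian_product
      by (intro sum.cong) auto
  qed
  have stat_F: "stationary (I \<times> J) lF F = (\<lambda>z. 0)"
    by (auto simp: stationary_def lF_def F_def freq_prod_def fun_eq_iff simp flip: of_real_add intro!: sum.neutral)
  have stat_B: "stationary B ?mB HB = (\<lambda>z. 0)"
    by (auto simp: stationary_def B_def fun_eq_iff intro!: sum.neutral)
  have re_inner_0: "re_inner (\<lambda>z. 0) Z = 0" for Z by (simp add: re_inner_def)

  let ?P = "\<lambda>t z. a' t z * f t z + a t z * f' t z"
  let ?R = "\<lambda>t z. ?P t z * b t z + a t z * f t z * b' t z"
  let ?S = "\<lambda>t z. b' t z * f t z + b t z * f' t z"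
  note defs = a_def[symmetric] b_def[symmetric] f_def[symmetric] g_def[symmetric]
     a'_def[symmetric] b'_def[symmetric] f'_def[symmetric] g'_def[symmetric]
  have slopes: "slope (A \<times> I) (freq_prod m l) (fun_prod H X) t = ?P t"
    "slope ((A \<times> I) \<times> B) (freq_prod (freq_prod m l) ?mB) (fun_prod (fun_prod H X) HB) t = ?R t"
    "slope (B \<times> I) (freq_prod ?mB l) (fun_prod HB X) t = ?S t"
    "translate (A \<times> I) (freq_prod m l) (fun_prod H X) t = (\<lambda>z. a t z * f t z)"
    "translate ((A \<times> I) \<times> B) (freq_prod (freq_prod m l) ?mB) (fun_prod (fun_prod H X) HB) t = (\<lambda>z. a t z * f t z * b t z)"
    "translate (B \<times> I) (freq_prod ?mB l) (fun_prod HB X) t = (\<lambda>z. b t z * f t z)" for t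
    by (auto simp: fun_eq_iff slope_prod translate_prod defs)
  have stat_afb: "stationary ((A \<times> I) \<times> B) (freq_prod (freq_prod m l) ?mB) (fun_prod (fun_prod H X) HB) = (\<lambda>z. 0)"
    using stationary_prod[OF fam_af fam_B] stat_B by (auto simp: fun_eq_iff)

  note LP_F = littlewood_paley[OF fam_F fam_A, unfolded slope_F stat_F re_inner_0 defs diff_0_right]
  note LP_af = littlewood_paley[OF fam_af fam_af, unfolded slopes defs]
  note LP_afb = littlewood_paley[OF fam_afb assms(1), unfolded slopes stat_afb re_inner_0 defs]
  note LP_bf = littlewood_paley[OF fam_bf fam_bf, unfolded slopes defs]
  note LP_f = littlewood_paley[OF assms(1,1), unfolded defs]
  note LP_g = littlewood_paley[OF assms(2,2), unfolded defs]
  note rhs = has_integral_add[OF has_integral_add[OF has_integral_mult_right[OF LP_g, of "1/2"]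
     has_integral_add[OF has_integral_add[OF LP_af has_integral_mult_right[OF LP_afb, of 2]] LP_bf]]
     has_integral_mult_right[OF LP_f, of 2]]
  have "re_inner (translate (I \<times> J) lF F 0) (a 0) \<le>
     1/2 * (re_inner (g 0) (g 0) - re_inner (stationary J k Y) (stationary J k Y)) +
     ((re_inner (\<lambda>z. a 0 z * f 0 z) (\<lambda>z. a 0 z * f 0 z) -
        re_inner (stationary (A \<times> I) (freq_prod m l) (fun_prod H X)) (stationary (A \<times> I) (freq_prod m l) (fun_prod H X))) +
       2 * (re_inner (\<lambda>z. a 0 z * f 0 z * b 0 z) (f 0) - 0) +
      (re_inner (\<lambda>z. b 0 z * f 0 z) (\<lambda>z. b 0 z * f 0 z) -
        re_inner (stationary (B \<times> I) (freq_prod ?mB l) (fun_prod HB X)) (stationary (B \<times> I) (freq_prod ?mB l) (fun_prod HB X)))) +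
     2 * (re_inner (f 0) (f 0) - re_inner (stationary I l X) (stationary I l X))"
  proof (rule has_integral_le[OF LP_F rhs])
    fix t :: real assume "t \<in> {0..}"
    then have t: "t \<ge> 0" by simp
    have "re_inner (\<lambda>z. f t z * g' t z) (a' t) \<le>
      1/2 * re_inner (g' t) (g' t) + (re_inner (?P t) (?P t) + 2 * re_inner (?R t) (f' t) + re_inner (?S t) (?S t))
        + 2 * re_inner (f' t) (f' t)"
      by (rule re_inner_estimate) (use bm u t in \<open>auto simp: a_def a'_def b_def b'_def f_def f'_def g'_def\<close>)
    from mult_left_mono[OF this, of "4 * t"] t
    show "4 * t * re_inner (\<lambda>z. f t z * g' t z) (a' t) \<le>
        1/2 * (4 * t * re_inner (g' t) (g' t)) + (4 * t * re_inner (?P t) (?P t) + 2 * (4 * t * re_inner (?R t) (f' t))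
        + 4 * t * re_inner (?S t) (?S t)) + 2 * (4 * t * re_inner (f' t) (f' t))"
      by (simp add: algebra_simps)
  qed
  \<comment> \<open>At t = 0 the three terms add up to the mean of |u f|^2, and |u| \<le> 1.\<close>
  moreover have "re_inner (\<lambda>z. a 0 z * f 0 z) (\<lambda>z. a 0 z * f 0 z) + 2 * re_inner (\<lambda>z. a 0 z * f 0 z * b 0 z) (f 0) +
     re_inner (\<lambda>z. b 0 z * f 0 z) (\<lambda>z. b 0 z * f 0 z) \<le> re_inner (f 0) (f 0)"
  proof -
    have b0: "bounded_measurable (a 0)" "bounded_measurable (b 0)" "bounded_measurable (f 0)"
      using bm by (auto simp: a_def b_def f_def)
    have b1: "bounded_measurable (\<lambda>z. a 0 z * f 0 z)" "bounded_measurable (\<lambda>z. a 0 z * f 0 z * b 0 z)"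
      "bounded_measurable (\<lambda>z. b 0 z * f 0 z)" by (intro bounded_measurable_intros b0)+
    note int = integrable_Re_inner[OF b1(1,1)] integrable_Re_inner[OF b1(2) b0(3)]
      integrable_Re_inner[OF b1(3,3)]
    have "(\<integral>z. Re (a 0 z * f 0 z * cnj (a 0 z * f 0 z)) + 2 * Re (a 0 z * f 0 z * b 0 z * cnj (f 0 z)) +
        Re (b 0 z * f 0 z * cnj (b 0 z * f 0 z)) \<partial>torus_measure) \<le> (\<integral>z. Re (f 0 z * cnj (f 0 z)) \<partial>torus_measure)"
    proof (rule integral_mono)
      fix z assume z: "z \<in> space torus_measure"
      have "Re (a 0 z * f 0 z * cnj (a 0 z * f 0 z)) + 2 * Re (a 0 z * f 0 z * b 0 z * cnj (f 0 z)) +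
        Re (b 0 z * f 0 z * cnj (b 0 z * f 0 z)) = (cmod ((a 0 z + cnj (b 0 z)) * f 0 z))\<^sup>2"
        unfolding cmod_power2 by (simp add: algebra_simps power2_eq_square)
      also have "\<dots> \<le> (1 * cmod (f 0 z))\<^sup>2"
        unfolding norm_mult by (intro power_mono mult_right_mono u z) auto
      also have "\<dots> = Re (f 0 z * cnj (f 0 z))" by (simp only: Re_mult_cnj_self mult_1)
      finally show "Re (a 0 z * f 0 z * cnj (a 0 z * f 0 z)) + 2 * Re (a 0 z * f 0 z * b 0 z * cnj (f 0 z)) +
        Re (b 0 z * f 0 z * cnj (b 0 z * f 0 z)) \<le> Re (f 0 z * cnj (f 0 z))" .
    qed (intro Bochner_Integration.integrable_add integrable_mult_right int integrable_Re_inner b0)+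
    then show ?thesis
      unfolding re_inner_eq[OF b1(1,1)] re_inner_eq[OF b1(2) b0(3)] re_inner_eq[OF b1(3,3)] re_inner_eq[OF b0(3,3)]
      by (simp only: Bochner_Integration.integral_add Bochner_Integration.integrable_add
        integrable_mult_right integral_mult_right_zero int)
  qed
  moreover have "re_inner (stationary J k Y) (stationary J k Y) \<ge> 0" "re_inner (stationary I l X) (stationary I l X) \<ge> 0"
     "re_inner (stationary (A \<times> I) (freq_prod m l) (fun_prod H X)) (stationary (A \<times> I) (freq_prod m l) (fun_prod H X)) \<ge> 0"
     "re_inner (stationary (B \<times> I) (freq_prod ?mB l) (fun_prod HB X)) (stationary (B \<times> I) (freq_prod ?mB l) (fun_prod HB X)) \<ge> 0"
    using analytic_family_bounded_measurable(3) assms(1,2) fam_af fam_bf re_inner_nonneg by blast+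
  ultimately have "re_inner (translate (I \<times> J) lF F 0) (a 0) \<le> 1/2 * re_inner (g 0) (g 0) + 3 * re_inner (f 0) (f 0)"
    by argo
  \<comment> \<open>The frequencies of \<open>F\<close> are nonnegative, so \<open>F\<close> is
    orthogonal to the terms of the test function with negative frequency, and only
    \<open>a 0\<close> is left of it.\<close>
  moreover have "re_inner (translate (I \<times> J) lF F 0) (\<lambda>z. \<Sum>p\<in>P. H p z) = re_inner (translate (I \<times> J) lF F 0) (a 0)"
  proof -
    have "(\<integral>z. F i z * cnj (H p z) \<partial>torus_measure) = 0" if "i \<in> I \<times> J" "p \<in> P - A" for i p
    proof (rule eigenfunction_orthogonal)
      have "lF i \<ge> 0" "m p < 0" using that fam_F unfolding analytic_family_def A_def by auto
      then show "lF i \<noteq> m p" by linarith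
      show "eigenfunction (lF i) (F i)" using that fam_F unfolding analytic_family_def by blast
      show "eigenfunction (m p) (H p)" using that P by auto
    qed
    then have "(\<Sum>i\<in>I \<times> J. \<Sum>p\<in>P. (\<integral>z. F i z * cnj (H p z) \<partial>torus_measure)) =
        (\<Sum>i\<in>I \<times> J. \<Sum>p\<in>A. (\<integral>z. F i z * cnj (H p z) \<partial>torus_measure))"
      using P by (intro sum.cong refl sum.mono_neutral_right) (auto simp: A_def)
    moreover have "bounded_measurable (F i)" if "i \<in> I \<times> J" for i
      using fam_F that by (auto simp: analytic_family_def intro: eigenfunction_bounded_measurable)
    moreover have "bounded_measurable (H p)" if "p \<in> P" for p
      using P that eigenfunction_bounded_measurable by blast
    moreover have "finite (I \<times> J)" "finite A" using fam_F fam_A by (auto simp: analytic_family_def)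
    ultimately show ?thesis
      using integral_sum_product[of "I \<times> J" P F H "\<lambda>_. 1" "\<lambda>_. 1"] P
        integral_sum_product[of "I \<times> J" A F H "\<lambda>_. 1" "\<lambda>_. 1"]
      by (simp add: re_inner_def a_def translate_def A_def)
  qed
  moreover have "translate (I \<times> J) lF F 0 = (\<lambda>z. \<Sum>(i, j)\<in>I \<times> J. of_real (k j / (l i + k j)) * (X i z * Y j z))"
    by (auto simp: translate_def F_def fun_eq_iff intro!: sum.cong)
  ultimately show ?thesis by (simp add: f_def g_def)
qed

section \<open>Trigonometric polynomials and duality for the L^1 norm\<close>

inductive trig_poly :: "((nat \<Rightarrow> complex) \<Rightarrow> complex) \<Rightarrow> bool" where
  zero: "trig_poly (\<lambda>z. 0)"
| step: "trig_poly X \<Longrightarrow> eigenfunction l Y \<Longrightarrow> trig_poly (\<lambda>z. X z + Y z)"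

lemma trig_poly_sum_rep:
  assumes "trig_poly X"
  obtains K :: nat and l H where "\<And>p. p < K \<Longrightarrow> eigenfunction (l p) (H p)" "X = (\<lambda>z. \<Sum>p<K. H p z)"
proof -
  have "\<exists>K l H. (\<forall>p<K. eigenfunction (l p) (H p)) \<and> X = (\<lambda>z. \<Sum>p<(K::nat). H p z)"
    using assms
  proof induction
    case zero
    show ?case by (rule exI[of _ 0]) auto
  next
    case (step X l Y)
    then obtain K m H where *: "\<forall>p<K. eigenfunction (m p) (H p)" "X = (\<lambda>z. \<Sum>p<(K::nat). H p z)"
      by blast
    show ?case
      by (rule exI[of _ "Suc K"], rule exI[of _ "m(K := l)"], rule exI[of _ "H(K := Y)"])
         (use * step in \<open>auto simp: less_Suc_eq intro!: sum.cong\<close>)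
  qed
  then show ?thesis using that by blast
qed

lemma trig_poly_eigenfunction: "eigenfunction l X \<Longrightarrow> trig_poly X"
  using trig_poly.step[OF trig_poly.zero] by simp

lemma trig_poly_add:
  assumes "trig_poly X" "trig_poly Y" shows "trig_poly (\<lambda>z. X z + Y z)"
  using assms(2)
proof induction
  case (step Y l V)
  then show ?case using trig_poly.step by (fastforce simp: add.assoc[symmetric])
qed (use assms in auto)

lemma trig_poly_mult:
  assumes "trig_poly X" "trig_poly Y" shows "trig_poly (\<lambda>z. X z * Y z)"
proof -
  have *: "trig_poly (\<lambda>z. X z * V z)" if "eigenfunction l V" for V l
    using assms(1)
  proof induction
    case (step X k W)
    then show ?case using trig_poly.step[OF step.IH eigenfunction_mult[OF step.hyps(2) that]]
      by (simp add: distrib_right)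
  qed (auto intro: trig_poly.zero)
  show ?thesis using assms(2)
  proof induction
    case (step Y l V)
    then show ?case using trig_poly_add[OF step.IH *[OF step.hyps(2)]] by (simp add: distrib_left)
  qed (auto intro: trig_poly.zero)
qed

lemma trig_poly_cnj: "trig_poly X \<Longrightarrow> trig_poly (\<lambda>z. cnj (X z))"
proof (induction rule: trig_poly.induct)
  case (step X l Y)
  then show ?case using trig_poly.step[OF step.IH eigenfunction_cnj[OF step.hyps(2)]] by simp
qed (auto intro: trig_poly.zero)

lemma trig_poly_const: "trig_poly (\<lambda>z. c)"
  by (rule trig_poly_eigenfunction[OF eigenfunction_const])

lemma trig_poly_power: "trig_poly X \<Longrightarrow> trig_poly (\<lambda>z. X z ^ n)"
  by (induction n) (auto intro: trig_poly_const trig_poly_mult)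

lemma trig_poly_sum: "(\<And>i. i \<in> I \<Longrightarrow> trig_poly (X i)) \<Longrightarrow> trig_poly (\<lambda>z. \<Sum>i\<in>I. X i z)"
  by (induction I rule: infinite_finite_induct) (auto intro: trig_poly_const trig_poly_add)

lemma trig_poly_bounded_measurable: "trig_poly X \<Longrightarrow> bounded_measurable X"
  by (induction rule: trig_poly.induct)
     (auto intro: bounded_measurable_const bounded_measurable_add eigenfunction_bounded_measurable)

text \<open>
  The unimodular function \<open>v / \<bar>v\<bar>\<close> dual to \<open>v\<close> is approximated by \<open>v p(\<bar>v\<bar>\<^sup>2)\<close>, where the polynomial
  \<open>p\<close> approximates \<open>1 / sqrt (s + \<epsilon>\<^sup>2)\<close>.
\<close>
lemma L1_norm_le_dual:
  assumes v: "trig_poly v"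
    and dual: "\<And>h. trig_poly h \<Longrightarrow> (\<And>z. z \<in> space torus_measure \<Longrightarrow> cmod (h z) \<le> 1) \<Longrightarrow> re_inner v h \<le> C"
  shows "(\<integral>z. cmod (v z) \<partial>torus_measure) \<le> C"
proof -
  interpret prob_space torus_measure by (rule prob_space_torus)
  have bm: "bounded_measurable v" using v by (rule trig_poly_bounded_measurable)
  then obtain B where B: "\<And>z. z \<in> space torus_measure \<Longrightarrow> cmod (v z) \<le> B"
    by (auto simp: bounded_measurable_def)
  obtain z0 where "z0 \<in> space torus_measure" using not_empty by auto
  then have "B \<ge> 0" using B norm_ge_zero order_trans by blast
  have est: "(\<integral>z. cmod (v z) \<partial>torus_measure) \<le> \<epsilon> + \<epsilon> * B\<^sup>2 + (1 + \<epsilon> * B) * C" if "\<epsilon> > 0" for \<epsilon> :: real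
  proof -
    define s where "s = (\<lambda>x::real. 1 / sqrt (x + \<epsilon>\<^sup>2))"
    have pos: "x + \<epsilon>\<^sup>2 > 0" if "x \<ge> 0" for x using that \<open>\<epsilon> > 0\<close> by (simp add: add_nonneg_pos)
    have "continuous_on {0..B\<^sup>2} s"
      unfolding s_def using pos by (intro continuous_intros) force
    then obtain q where q: "real_polynomial_function q" "\<And>x. x \<in> {0..B\<^sup>2} \<Longrightarrow> \<bar>s x - q x\<bar> < \<epsilon>"
      using Stone_Weierstrass_real_polynomial_function[OF compact_Icc _ \<open>\<epsilon> > 0\<close>, of 0 "B\<^sup>2" s] by blast
    obtain c n where qc: "q = (\<lambda>x. \<Sum>i\<le>(n::nat). c i * x ^ i)"
      using q(1) unfolding real_polynomial_function_iff_sum by blast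
    \<comment> \<open>As \<open>q\<close> is within \<epsilon> of \<open>s\<close> and s(|v|^2) |v|
      \<le> 1, the product q(|v|^2) |v| is only known to be at most 1 + \<epsilon> B; the scalar
      factor restores the bound 1.\<close>
    define h where "h = (\<lambda>z. of_real (1 / (1 + \<epsilon> * B)) * (v z * (\<Sum>i\<le>n. of_real (c i) * (v z * cnj (v z)) ^ i)))"
    have h: "h z = of_real (q ((cmod (v z))\<^sup>2) / (1 + \<epsilon> * B)) * v z" for z
      by (simp add: h_def qc complex_norm_square[symmetric])
    have pB: "1 + \<epsilon> * B > 0" using \<open>\<epsilon> > 0\<close> \<open>B \<ge> 0\<close> by (simp add: add_pos_nonneg)
    have "trig_poly h" unfolding h_def
      by (intro trig_poly_mult trig_poly_const trig_poly_sum trig_poly_power trig_poly_cnj v)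
    have range: "(cmod (v z))\<^sup>2 \<in> {0..B\<^sup>2}" if "z \<in> space torus_measure" for z
      using B[OF that] by (auto intro: power_mono)
    have "cmod (h z) \<le> 1" if z: "z \<in> space torus_measure" for z
    proof -
      let ?x = "cmod (v z)"
      have "\<bar>q (?x\<^sup>2)\<bar> \<le> s (?x\<^sup>2) + \<epsilon>"
      proof -
        have "s (?x\<^sup>2) \<ge> 0" by (simp add: s_def)
        then show ?thesis using q(2)[OF range[OF z]] unfolding abs_less_iff abs_le_iff by argo
      qed
      then have "\<bar>q (?x\<^sup>2)\<bar> * ?x \<le> (s (?x\<^sup>2) + \<epsilon>) * ?x" by (intro mult_right_mono) auto
      also have "\<dots> = s (?x\<^sup>2) * ?x + \<epsilon> * ?x" by (simp add: distrib_right)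
      also have "s (?x\<^sup>2) * ?x \<le> 1"
      proof -
        have "?x \<le> sqrt (?x\<^sup>2 + \<epsilon>\<^sup>2)" by (rule real_le_rsqrt) simp
        then show ?thesis using pos[of "?x\<^sup>2"] by (simp add: s_def divide_le_eq)
      qed
      also have "\<epsilon> * ?x \<le> \<epsilon> * B" using B[OF z] \<open>\<epsilon> > 0\<close> by simp
      finally have "\<bar>q (?x\<^sup>2)\<bar> * ?x / (1 + \<epsilon> * B) \<le> 1" using pB by (simp add: divide_le_eq)
      also have "\<bar>q (?x\<^sup>2)\<bar> * ?x / (1 + \<epsilon> * B) = cmod (h z)"
        unfolding h norm_mult norm_of_real abs_divide abs_of_pos[OF pB] by simp
      finally show ?thesis .
    qed
    with \<open>trig_poly h\<close> have "re_inner v h \<le> C" by (rule dual)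
    moreover have "((\<integral>z. cmod (v z) \<partial>torus_measure) - \<epsilon> - \<epsilon> * B\<^sup>2) / (1 + \<epsilon> * B) \<le> re_inner v h"
    proof -
      have bh: "bounded_measurable h" using \<open>trig_poly h\<close> by (rule trig_poly_bounded_measurable)
      have int: "integrable torus_measure (\<lambda>z. cmod (v z))"
        by (intro integrable_norm bounded_measurable_integrable bm)
      have "(\<integral>z. (cmod (v z) - (\<epsilon> + \<epsilon> * B\<^sup>2)) / (1 + \<epsilon> * B) \<partial>torus_measure) \<le> (\<integral>z. Re (v z * cnj (h z)) \<partial>torus_measure)"
      proof (rule integral_mono)
        show "integrable torus_measure (\<lambda>z. (cmod (v z) - (\<epsilon> + \<epsilon> * B\<^sup>2)) / (1 + \<epsilon> * B))"
          by (intro integrable_divide Bochner_Integration.integrable_diff int) simp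
        show "integrable torus_measure (\<lambda>z. Re (v z * cnj (h z)))" by (rule integrable_Re_inner[OF bm bh])
        fix z assume z: "z \<in> space torus_measure"
        let ?x = "cmod (v z)"
        have "v z * cnj (h z) = of_real (q (?x\<^sup>2) / (1 + \<epsilon> * B)) * of_real (?x\<^sup>2)"
          unfolding complex_norm_square by (simp add: h mult_ac)
        then have "Re (v z * cnj (h z)) = q (?x\<^sup>2) * ?x\<^sup>2 / (1 + \<epsilon> * B)"
          by (metis Re_complex_of_real of_real_mult times_divide_eq_left)
        \<comment> \<open>Because sqrt (x^2 + \<epsilon>^2) \<le> x + \<epsilon>, using
          \<open>s\<close> in place of 1 / x costs at most \<epsilon>; the error of \<open>q\<close>
          costs at most \<epsilon> B^2.\<close>
        moreover have "?x - (\<epsilon> + \<epsilon> * B\<^sup>2) \<le> q (?x\<^sup>2) * ?x\<^sup>2"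
        proof -
          have "sqrt (?x\<^sup>2 + \<epsilon>\<^sup>2) \<le> ?x + \<epsilon>"
            using \<open>\<epsilon> > 0\<close> by (intro real_le_lsqrt) (auto simp: power2_sum)
          moreover have "0 < sqrt (?x\<^sup>2 + \<epsilon>\<^sup>2)" using pos[of "?x\<^sup>2"] by simp
          moreover have "(?x - \<epsilon>) * (?x + \<epsilon>) \<le> ?x\<^sup>2" by (simp add: algebra_simps power2_eq_square)
          moreover have "?x - \<epsilon> \<le> ?x\<^sup>2 / sqrt (?x\<^sup>2 + \<epsilon>\<^sup>2)"
          proof (cases "?x \<le> \<epsilon>")
            case True
            then show ?thesis using calculation(2) by (smt (verit) divide_nonneg_pos zero_le_power2)
          next
            case False
            have "(?x - \<epsilon>) * sqrt (?x\<^sup>2 + \<epsilon>\<^sup>2) \<le> (?x - \<epsilon>) * (?x + \<epsilon>)"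
              using False calculation by (intro mult_left_mono) auto
            then show ?thesis using calculation by (simp add: le_divide_eq)
          qed
          moreover have "(s (?x\<^sup>2) - \<epsilon>) * ?x\<^sup>2 \<le> q (?x\<^sup>2) * ?x\<^sup>2"
            using q(2)[OF range[OF z]] by (intro mult_right_mono) (auto simp: abs_less_iff)
          moreover have "\<epsilon> * ?x\<^sup>2 \<le> \<epsilon> * B\<^sup>2" using range[OF z] \<open>\<epsilon> > 0\<close> by simp
          ultimately show ?thesis by (simp add: s_def left_diff_distrib)
        qed
        ultimately show "(?x - (\<epsilon> + \<epsilon> * B\<^sup>2)) / (1 + \<epsilon> * B) \<le> Re (v z * cnj (h z))"
          using pB by (simp add: divide_right_mono)
      qed
      also have "(\<integral>z. (cmod (v z) - (\<epsilon> + \<epsilon> * B\<^sup>2)) / (1 + \<epsilon> * B) \<partial>torus_measure) =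
          ((\<integral>z. cmod (v z) \<partial>torus_measure) - (\<epsilon> + \<epsilon> * B\<^sup>2)) / (1 + \<epsilon> * B)"
        using int by (simp add: Bochner_Integration.integral_diff prob_space)
      finally show ?thesis unfolding re_inner_eq[OF bm bh] by (simp add: diff_diff_eq)
    qed
    ultimately have "((\<integral>z. cmod (v z) \<partial>torus_measure) - \<epsilon> - \<epsilon> * B\<^sup>2) / (1 + \<epsilon> * B) \<le> C" by simp
    then have "(\<integral>z. cmod (v z) \<partial>torus_measure) - \<epsilon> - \<epsilon> * B\<^sup>2 \<le> (1 + \<epsilon> * B) * C"
      using pB by (simp add: divide_le_eq mult.commute)
    then show ?thesis by argo
  qed
  have "((\<lambda>\<epsilon>. \<epsilon> + \<epsilon> * B\<^sup>2 + (1 + \<epsilon> * B) * C) \<longlongrightarrow> 0 + 0 * B\<^sup>2 + (1 + 0 * B) * C) (at_right 0)"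
    by (intro tendsto_intros)
  then have "(\<integral>z. cmod (v z) \<partial>torus_measure) \<le> 0 + 0 * B\<^sup>2 + (1 + 0 * B) * C"
    by (rule tendsto_lowerbound) (use est in \<open>auto simp: eventually_at_filter\<close>)
  then show ?thesis by simp
qed

section \<open>The L^1 bound for Dirichlet polynomials\<close>

definition truncated_H2_norm :: "nat \<Rightarrow> (nat \<Rightarrow> complex) \<Rightarrow> real" where
  "truncated_H2_norm N a = sqrt (\<Sum>n=1..N. (cmod (a n))\<^sup>2)"

text \<open>
  The Bohr lift of the primitive \<open>F\<close> of \<open>a b'\<close>: the coefficient of \<open>F'\<close> at \<open>i j\<close> is divided by
  \<open>ln (i j) = ln i + ln j\<close>. The term \<open>i = j = 1\<close> vanishes because \<open>x / 0 = 0\<close>.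
\<close>
definition paraproduct :: "nat \<Rightarrow> (nat \<Rightarrow> complex) \<Rightarrow> (nat \<Rightarrow> complex) \<Rightarrow> (nat \<Rightarrow> complex) \<Rightarrow> complex" where
  "paraproduct N a b z = (\<Sum>(i, j)\<in>{1..N} \<times> {1..N}.
     of_real (ln (real j) / (ln (real i) + ln (real j))) * (a i * chi i z * (b j * chi j z)))"

lemma re_inner_dirichlet_poly:
  "re_inner (translate {1..N} (\<lambda>n. ln (real n)) (\<lambda>n z. a n * chi n z) 0)
     (translate {1..N} (\<lambda>n. ln (real n)) (\<lambda>n z. a n * chi n z) 0) = (\<Sum>n=1..N. (cmod (a n))\<^sup>2)"
proof -
  have eq: "translate {1..N} (\<lambda>n. ln (real n)) (\<lambda>n z. a n * chi n z) 0 = (\<lambda>z. \<Sum>n\<in>{1..N}. a n * chi n z)"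
    by (simp add: translate_def fun_eq_iff)
  have "(\<integral>z. (\<Sum>n\<in>{1..N}. a n * chi n z) * cnj (\<Sum>n\<in>{1..N}. a n * chi n z) \<partial>torus_measure) =
      (\<Sum>m\<in>{1..N}. \<Sum>n\<in>{1..N}. a m * cnj (a n) * (\<integral>z. chi m z * cnj (chi n z) \<partial>torus_measure))"
    by (rule integral_sum_product) (auto intro: bounded_measurable_monomial)
  also have "\<dots> = (\<Sum>m\<in>{1..N}. \<Sum>n\<in>{1..N}. a m * cnj (a n) * (if m = n then 1 else 0))"
    by (intro sum.cong refl) (simp add: integral_chi)
  also have "\<dots> = (\<Sum>m\<in>{1..N}. of_real ((cmod (a m))\<^sup>2))"
    by (intro sum.cong refl) (simp add: sum.delta if_distrib complex_norm_square[symmetric] cong: if_cong)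
  finally show ?thesis unfolding re_inner_def eq by simp
qed

lemma dirichlet_family: "analytic_family {1..N} (\<lambda>n. ln (real n)) (\<lambda>n z. a n * chi n z)"
  by (auto simp: analytic_family_def intro: eigenfunction_chi)

lemma trig_poly_chi: "n \<ge> 1 \<Longrightarrow> trig_poly (\<lambda>z. c * chi n z)"
  by (rule trig_poly_eigenfunction[OF eigenfunction_chi])

lemma trig_poly_paraproduct: "trig_poly (paraproduct N a b)"
  unfolding paraproduct_def split_def
  by (intro trig_poly_sum trig_poly_mult[OF trig_poly_const] trig_poly_mult[OF trig_poly_chi trig_poly_chi]) auto

lemma paraproduct_L1_sum:
  "(\<integral>z. cmod (paraproduct N a b z) \<partial>torus_measure) \<le>
     1/2 * (\<Sum>n=1..N. (cmod (b n))\<^sup>2) + 3 * (\<Sum>n=1..N. (cmod (a n))\<^sup>2)"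
proof (rule L1_norm_le_dual[OF trig_poly_paraproduct])
  fix h assume h: "trig_poly h" "\<And>z. z \<in> space torus_measure \<Longrightarrow> cmod (h z) \<le> 1"
  obtain K :: nat and l H where H: "\<And>p. p < K \<Longrightarrow> eigenfunction (l p) (H p)" "h = (\<lambda>z. \<Sum>p<K. H p z)"
    using trig_poly_sum_rep[OF h(1)] by metis
  show "re_inner (paraproduct N a b) h \<le> 1/2 * (\<Sum>n=1..N. (cmod (b n))\<^sup>2) + 3 * (\<Sum>n=1..N. (cmod (a n))\<^sup>2)"
    using bilinear_estimate[OF dirichlet_family[of N a] dirichlet_family[of N b], of "{..<K}" l H] h H
    unfolding re_inner_dirichlet_poly by (simp add: paraproduct_def[abs_def])
qed

text \<open>\<open>paraproduct_L1_sum\<close> is not homogeneous, but replacing \<open>a\<close> by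
  \<open>c * a\<close> and \<open>b\<close> by \<open>b / c\<close> leaves the paraproduct
  unchanged. With c^2 = B / A both sums become A B, and 1/2 + 3 = 7/2. If one norm is 0, the
  paraproduct itself vanishes.\<close>

lemma paraproduct_L1:
  "(\<integral>z. cmod (paraproduct N a b z) \<partial>torus_measure) \<le> 7/2 * (truncated_H2_norm N a * truncated_H2_norm N b)"
proof (cases "truncated_H2_norm N a = 0 \<or> truncated_H2_norm N b = 0")
  case True
  then have "(\<forall>n\<in>{1..N}. a n = 0) \<or> (\<forall>n\<in>{1..N}. b n = 0)"
    by (auto simp: truncated_H2_norm_def sum_nonneg_eq_0_iff)
  then have "paraproduct N a b z = 0" for z
    unfolding paraproduct_def by (intro sum.neutral) auto
  then show ?thesis by (simp add: truncated_H2_norm_def sum_nonneg)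
next
  case False
  define A B where "A = truncated_H2_norm N a" and "B = truncated_H2_norm N b"
  have pos: "A > 0" "B > 0" using False by (auto simp: A_def B_def truncated_H2_norm_def less_le sum_nonneg)
  have sq: "(\<Sum>n=1..N. (cmod (a n))\<^sup>2) = A\<^sup>2" "(\<Sum>n=1..N. (cmod (b n))\<^sup>2) = B\<^sup>2"
    by (auto simp: A_def B_def truncated_H2_norm_def sum_nonneg)
  define c where "c = sqrt (B / A)"
  have c: "c > 0" "c\<^sup>2 = B / A" using pos by (auto simp: c_def)
  have "paraproduct N a b = paraproduct N (\<lambda>n. c * a n) (\<lambda>n. b n / c)"
    using c(1) by (auto simp: paraproduct_def fun_eq_iff intro!: sum.cong)
  then have "(\<integral>z. cmod (paraproduct N a b z) \<partial>torus_measure) \<le>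
     1/2 * (\<Sum>n=1..N. (cmod (b n / c))\<^sup>2) + 3 * (\<Sum>n=1..N. (cmod (c * a n))\<^sup>2)"
    by (metis paraproduct_L1_sum)
  also have "(\<Sum>n=1..N. (cmod (b n / c))\<^sup>2) = A * B"
  proof -
    have "(\<Sum>n=1..N. (cmod (b n / c))\<^sup>2) = (\<Sum>n=1..N. (cmod (b n))\<^sup>2) / c\<^sup>2"
      by (simp add: norm_divide power_divide sum_divide_distrib)
    then show ?thesis using pos unfolding sq c by (simp add: power2_eq_square)
  qed
  also have "(\<Sum>n=1..N. (cmod (c * a n))\<^sup>2) = A * B"
  proof -
    have "(\<Sum>n=1..N. (cmod (c * a n))\<^sup>2) = c\<^sup>2 * (\<Sum>n=1..N. (cmod (a n))\<^sup>2)"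
      by (simp add: norm_mult power_mult_distrib sum_distrib_left)
    then show ?thesis using pos unfolding sq c by (simp add: power2_eq_square)
  qed
  finally show ?thesis by (simp add: A_def B_def)
qed

section \<open>Completion\<close>

lemma analytic_polynomialsI:
  assumes "\<And>z. \<phi> z = (\<Sum>\<alpha>\<in>A. c \<alpha> * monomial \<alpha> z)" "finite A" "\<forall>\<alpha>\<in>A. finite {j. \<alpha> j \<noteq> 0}"
  shows "\<phi> \<in> analytic_polynomials"
proof -
  have "\<phi> = (\<lambda>z. \<Sum>\<alpha>\<in>A. c \<alpha> * monomial \<alpha> z)" using assms(1) by (rule ext)
  then show ?thesis using assms(2,3) unfolding analytic_polynomials_def mem_Collect_eq by blast
qed

text \<open>Several indices may lead to the same exponent, whereas an analytic polynomial has one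
  coefficient per exponent; hence the coefficients are summed over the fibres.\<close>

lemma analytic_polynomials_chi_sum:
  assumes "finite P" "\<And>p. p \<in> P \<Longrightarrow> q p \<ge> 1"
  shows "(\<lambda>z. \<Sum>p\<in>P. c p * chi (q p) z) \<in> analytic_polynomials"
proof -
  let ?A = "(\<lambda>p. kappa (q p)) ` P" and ?c = "\<lambda>\<alpha>. \<Sum>p\<in>{p\<in>P. kappa (q p) = \<alpha>}. c p"
  have "(\<Sum>p\<in>P. c p * chi (q p) z) = (\<Sum>\<alpha>\<in>?A. ?c \<alpha> * monomial \<alpha> z)" for z
    using assms(1) by (subst sum.image_gen[where g = "\<lambda>p. kappa (q p)"]) (auto simp: sum_distrib_right intro!: sum.cong)
  moreover have "finite ?A" "\<forall>\<alpha>\<in>?A. finite {j. \<alpha> j \<noteq> 0}" using assms finite_kappa by auto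
  ultimately show ?thesis by (rule analytic_polynomialsI)
qed

lemma analytic_polynomials_add:
  assumes "\<phi> \<in> analytic_polynomials" "\<psi> \<in> analytic_polynomials"
  shows "(\<lambda>z. \<phi> z + \<psi> z) \<in> analytic_polynomials"
proof -
  obtain A c where A: "\<phi> = (\<lambda>z. \<Sum>\<alpha>\<in>A. c \<alpha> * monomial \<alpha> z)" "finite A" "\<forall>\<alpha>\<in>A. finite {j. \<alpha> j \<noteq> 0}"
    using assms(1) by (auto simp: analytic_polynomials_def)
  obtain B d where B: "\<psi> = (\<lambda>z. \<Sum>\<alpha>\<in>B. d \<alpha> * monomial \<alpha> z)" "finite B" "\<forall>\<alpha>\<in>B. finite {j. \<alpha> j \<noteq> 0}"
    using assms(2) by (auto simp: analytic_polynomials_def)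
  let ?e = "\<lambda>\<alpha>. (if \<alpha> \<in> A then c \<alpha> else 0) + (if \<alpha> \<in> B then d \<alpha> else 0)"
  have "\<phi> z + \<psi> z = (\<Sum>\<alpha>\<in>A \<union> B. ?e \<alpha> * monomial \<alpha> z)" for z
  proof -
    have "\<phi> z = (\<Sum>\<alpha>\<in>A \<union> B. (if \<alpha> \<in> A then c \<alpha> else 0) * monomial \<alpha> z)"
      unfolding A(1) using A B by (intro sum.mono_neutral_cong_left) auto
    moreover have "\<psi> z = (\<Sum>\<alpha>\<in>A \<union> B. (if \<alpha> \<in> B then d \<alpha> else 0) * monomial \<alpha> z)"
      unfolding B(1) using A B by (intro sum.mono_neutral_cong_left) auto
    ultimately show ?thesis by (simp add: distrib_right sum.distrib)
  qed
  moreover have "finite (A \<union> B)" "\<forall>\<alpha>\<in>A \<union> B. finite {j. \<alpha> j \<noteq> 0}" using A B by auto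
  ultimately show ?thesis by (rule analytic_polynomialsI)
qed

lemma analytic_polynomials_integrable:
  assumes "\<phi> \<in> analytic_polynomials" shows "integrable torus_measure \<phi>"
proof -
  obtain A c where "\<phi> = (\<lambda>z. \<Sum>\<alpha>\<in>A. c \<alpha> * monomial \<alpha> z)"
    using assms by (auto simp: analytic_polynomials_def)
  then show ?thesis by (simp only:) (intro bounded_measurable_integrable bounded_measurable_intros)
qed

lemma analytic_polynomials_H1_torus: "\<phi> \<in> analytic_polynomials \<Longrightarrow> \<phi> \<in> H1_torus"
  unfolding H1_torus_def mem_Collect_eq
  by (intro conjI allI impI analytic_polynomials_integrable bexI[of _ \<phi>]) auto

lemma H1_torus_approx:
  assumes "u \<in> H1_torus" "\<epsilon> > 0"
  obtains \<phi> where "\<phi> \<in> analytic_polynomials" "(LINT z|torus_measure. cmod (u z - \<phi> z)) < \<epsilon>"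
  using assms unfolding H1_torus_def by blast

lemma L1_triangle:
  fixes u v w :: "'a \<Rightarrow> complex"
  assumes "integrable M u" "integrable M v" "integrable M w"
  shows "(\<integral>z. cmod (u z - w z) \<partial>M) \<le> (\<integral>z. cmod (u z - v z) \<partial>M) + (\<integral>z. cmod (v z - w z) \<partial>M)"
proof -
  have "(\<integral>z. cmod (u z - w z) \<partial>M) \<le> (\<integral>z. cmod (u z - v z) + cmod (v z - w z) \<partial>M)"
    using assms by (intro integral_mono) (auto intro!: norm_diff_triangle_le)
  then show ?thesis using assms by simp
qed

lemma H1_torus_integrable: "u \<in> H1_torus \<Longrightarrow> integrable torus_measure u"
  by (simp add: H1_torus_def)

lemma H1_torus_add:
  assumes "u \<in> H1_torus" "v \<in> H1_torus" shows "(\<lambda>z. u z + v z) \<in> H1_torus"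
proof -
  have "\<exists>\<phi>\<in>analytic_polynomials. (LINT z|torus_measure. cmod (u z + v z - \<phi> z)) < \<epsilon>" if "\<epsilon> > 0" for \<epsilon> :: real
  proof -
    have "\<epsilon> / 2 > 0" using that by simp
    then obtain \<phi> \<psi> where *: "\<phi> \<in> analytic_polynomials" "(LINT z|torus_measure. cmod (u z - \<phi> z)) < \<epsilon> / 2"
       "\<psi> \<in> analytic_polynomials" "(LINT z|torus_measure. cmod (v z - \<psi> z)) < \<epsilon> / 2"
      using H1_torus_approx[OF assms(1)] H1_torus_approx[OF assms(2)] by metis
    have int: "integrable torus_measure u" "integrable torus_measure v" "integrable torus_measure \<phi>" "integrable torus_measure \<psi>"
      using assms * by (auto intro: H1_torus_integrable analytic_polynomials_integrable)
    have "(LINT z|torus_measure. cmod (u z + v z - (\<phi> z + \<psi> z))) \<le>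
       (LINT z|torus_measure. cmod (u z - \<phi> z) + cmod (v z - \<psi> z))"
      using int by (intro integral_mono) (auto intro: norm_diff_triangle_ineq)
    also have "\<dots> < \<epsilon>" using int * by simp
    finally show ?thesis by (intro bexI[OF _ analytic_polynomials_add[OF *(1,3)]])
  qed
  then show ?thesis using assms by (auto simp: H1_torus_def)
qed

lemma H1_torus_limit:
  assumes "\<And>n. u n \<in> H1_torus" "integrable torus_measure v"
    "(\<lambda>n. LINT z|torus_measure. cmod (u n z - v z)) \<longlonglongrightarrow> 0"
  shows "v \<in> H1_torus"
proof -
  have "\<exists>\<phi>\<in>analytic_polynomials. (LINT z|torus_measure. cmod (v z - \<phi> z)) < \<epsilon>" if "\<epsilon> > 0" for \<epsilon> :: real
  proof -
    have half: "\<epsilon> / 2 > 0" using that by simp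
    have "eventually (\<lambda>n. (LINT z|torus_measure. cmod (u n z - v z)) < \<epsilon> / 2) sequentially"
      using assms(3) half by (rule order_tendstoD(2))
    then obtain n where n: "(LINT z|torus_measure. cmod (u n z - v z)) < \<epsilon> / 2"
      unfolding eventually_sequentially by blast
    obtain \<phi> where \<phi>: "\<phi> \<in> analytic_polynomials" "(LINT z|torus_measure. cmod (u n z - \<phi> z)) < \<epsilon> / 2"
      using H1_torus_approx[OF assms(1) half] by blast
    have "(LINT z|torus_measure. cmod (v z - \<phi> z)) \<le>
       (LINT z|torus_measure. cmod (v z - u n z)) + (LINT z|torus_measure. cmod (u n z - \<phi> z))"
      by (intro L1_triangle assms H1_torus_integrable analytic_polynomials_integrable \<phi>)
    also have "\<dots> < \<epsilon>" using n \<phi> by (simp add: norm_minus_commute)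
    finally show ?thesis using \<phi> by blast
  qed
  then show ?thesis using assms by (simp add: H1_torus_def)
qed

text \<open>A subsequence that is Cauchy almost everywhere supplies the limit. Fatou's lemma along
  it turns the Cauchy estimate into an estimate of the distance to the limit, valid for the whole
  sequence.\<close>

lemma L1_complete:
  fixes u :: "nat \<Rightarrow> 'a \<Rightarrow> complex"
  assumes u: "\<And>n. integrable M (u n)"
    and cauchy: "\<And>e. e > 0 \<Longrightarrow> \<exists>N. \<forall>i\<ge>N. \<forall>j\<ge>N. (\<integral>x. cmod (u i x - u j x) \<partial>M) < e"
  obtains v where "integrable M v" "(\<lambda>n. \<integral>x. cmod (u n x - v x) \<partial>M) \<longlonglongrightarrow> 0"
proof -
  obtain r where r: "strict_mono r" "AE x in M. Cauchy (\<lambda>i. u (r i) x)"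
    using cauchy_L1_AE_cauchy_subseq[of M u] u cauchy by blast
  define v where "v = (\<lambda>x. lim (\<lambda>i. u (r i) x))"
  have [measurable]: "u n \<in> borel_measurable M" for n using u by auto
  have [measurable]: "v \<in> borel_measurable M" unfolding v_def by measurable
  have conv: "AE x in M. (\<lambda>i. u (r i) x) \<longlonglongrightarrow> v x"
    using r(2) by eventually_elim (simp add: v_def Cauchy_convergent_iff convergent_LIMSEQ_iff)
  have fatou: "(\<integral>\<^sup>+x. cmod (u n x - v x) \<partial>M) \<le> ennreal e"
    if N: "\<forall>i\<ge>N. \<forall>j\<ge>N. (\<integral>x. cmod (u i x - u j x) \<partial>M) < e" "n \<ge> N" for n N e
  proof -
    have "(\<integral>\<^sup>+x. cmod (u n x - v x) \<partial>M) = (\<integral>\<^sup>+x. liminf (\<lambda>i. ennreal (cmod (u n x - u (r i) x))) \<partial>M)"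
    proof (rule nn_integral_cong_AE)
      show "AE x in M. ennreal (cmod (u n x - v x)) = liminf (\<lambda>i. ennreal (cmod (u n x - u (r i) x)))"
        using conv
      proof eventually_elim
        case (elim x)
        have "(\<lambda>i. ennreal (cmod (u n x - u (r i) x))) \<longlonglongrightarrow> ennreal (cmod (u n x - v x))"
          by (intro tendsto_intros elim)
        then show ?case by (rule lim_imp_Liminf[OF trivial_limit_sequentially, symmetric])
      qed
    qed
    also have "\<dots> \<le> liminf (\<lambda>i. \<integral>\<^sup>+x. ennreal (cmod (u n x - u (r i) x)) \<partial>M)"
      by (rule nn_integral_liminf) measurable
    also have "\<dots> \<le> liminf (\<lambda>i. ennreal e)"
    proof (rule Liminf_mono)
      have "eventually (\<lambda>i. i \<ge> N) sequentially" by (rule eventually_ge_at_top)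
      then show "\<forall>\<^sub>F i in sequentially. (\<integral>\<^sup>+x. ennreal (cmod (u n x - u (r i) x)) \<partial>M) \<le> ennreal e"
      proof eventually_elim
        case (elim i)
        then have "r i \<ge> N" using seq_suble[OF r(1), of i] by simp
        then have "(\<integral>x. cmod (u n x - u (r i) x) \<partial>M) \<le> e" using N less_imp_le by blast
        then show ?case using u by (subst nn_integral_eq_integral) (auto intro: ennreal_leI)
      qed
    qed
    also have "\<dots> = ennreal e" by (simp add: Liminf_const)
    finally show ?thesis .
  qed
  have int_diff: "integrable M (\<lambda>x. u n x - v x)"
    if "\<forall>i\<ge>N. \<forall>j\<ge>N. (\<integral>x. cmod (u i x - u j x) \<partial>M) < e" "n \<ge> N" for n N e
    using fatou[OF that] by (intro integrableI_bounded) (auto intro: le_less_trans)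
  obtain N1 where N1: "\<forall>i\<ge>N1. \<forall>j\<ge>N1. (\<integral>x. cmod (u i x - u j x) \<partial>M) < 1" using cauchy[of 1] by auto
  have "integrable M (\<lambda>x. u N1 x - (u N1 x - v x))"
    by (intro Bochner_Integration.integrable_diff u int_diff[OF N1]) simp
  then have v: "integrable M v" by simp
  moreover have "(\<lambda>n. \<integral>x. cmod (u n x - v x) \<partial>M) \<longlonglongrightarrow> 0"
  proof (rule LIMSEQ_I)
    fix e :: real assume "e > 0"
    then obtain N where N: "\<forall>i\<ge>N. \<forall>j\<ge>N. (\<integral>x. cmod (u i x - u j x) \<partial>M) < e / 2"
      using cauchy[of "e / 2"] by auto
    have "norm ((\<integral>x. cmod (u n x - v x) \<partial>M) - 0) < e" if "n \<ge> N" for n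
    proof -
      have "ennreal (\<integral>x. cmod (u n x - v x) \<partial>M) \<le> ennreal (e / 2)"
        using fatou[OF N that] u v by (subst nn_integral_eq_integral[symmetric]) auto
      then have "(\<integral>x. cmod (u n x - v x) \<partial>M) \<le> e / 2" using \<open>e > 0\<close> by (simp add: ennreal_le_iff)
      then show ?thesis using \<open>e > 0\<close> by (simp add: integral_nonneg_AE)
    qed
    then show "\<exists>no. \<forall>n\<ge>no. norm ((\<integral>x. cmod (u n x - v x) \<partial>M) - 0) < e" by blast
  qed
  ultimately show ?thesis using that by blast
qed

section \<open>Dirichlet series with a lift of controlled norm\<close>

definition has_lift :: "dseries \<Rightarrow> real \<Rightarrow> bool" where
  "has_lift a C \<longleftrightarrow> (\<exists>u\<in>H1_torus. is_bohr_lift a u \<and> (LINT z|torus_measure. cmod (u z)) \<le> C)"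

lemma integrable_fourier:
  assumes "integrable torus_measure u"
  shows "integrable torus_measure (\<lambda>z. u z * cnj (monomial \<alpha> z))"
proof (rule Bochner_Integration.integrable_bound[OF assms])
  show "AE z in torus_measure. norm (u z * cnj (monomial \<alpha> z)) \<le> norm (u z)"
    by (auto simp: norm_mult norm_monomial)
  show "(\<lambda>z. u z * cnj (monomial \<alpha> z)) \<in> borel_measurable torus_measure"
    using assms by measurable
qed

text \<open>Monomials have modulus 1 on the torus, so Fourier coefficients are contractions from L^1
  to the scalars; this carries them through L^1 limits.\<close>

lemma fourier_coefficient_diff_le:
  assumes "integrable torus_measure u" "integrable torus_measure v"
  shows "cmod ((LINT z|torus_measure. u z * cnj (monomial \<alpha> z)) - (LINT z|torus_measure. v z * cnj (monomial \<alpha> z)))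
     \<le> (LINT z|torus_measure. cmod (u z - v z))"
proof -
  have "(LINT z|torus_measure. u z * cnj (monomial \<alpha> z)) - (LINT z|torus_measure. v z * cnj (monomial \<alpha> z)) =
     (LINT z|torus_measure. (u z - v z) * cnj (monomial \<alpha> z))"
    using assms integrable_fourier by (simp add: left_diff_distrib)
  also have "cmod \<dots> \<le> (LINT z|torus_measure. cmod ((u z - v z) * cnj (monomial \<alpha> z)))"
    by (rule integral_norm_bound)
  also have "\<dots> = (LINT z|torus_measure. cmod (u z - v z))"
    by (intro Bochner_Integration.integral_cong) (auto simp: norm_mult norm_monomial)
  finally show ?thesis .
qed

lemma is_bohr_lift_add:
  assumes "u \<in> H1_torus" "v \<in> H1_torus" "is_bohr_lift a u" "is_bohr_lift b v"
  shows "is_bohr_lift (\<lambda>n. a n + b n) (\<lambda>z. u z + v z)"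
  unfolding is_bohr_lift_def distrib_right
  using assms(3,4) Bochner_Integration.integral_add[OF integrable_fourier integrable_fourier] assms(1,2)
  by (simp add: is_bohr_lift_def H1_torus_integrable)

lemma L1_norm_add_le:
  assumes "u \<in> H1_torus" "v \<in> H1_torus"
  shows "(LINT z|torus_measure. cmod (u z + v z)) \<le> (LINT z|torus_measure. cmod (u z)) + (LINT z|torus_measure. cmod (v z))"
proof -
  have "(LINT z|torus_measure. cmod (u z + v z)) \<le> (LINT z|torus_measure. cmod (u z) + cmod (v z))"
    by (intro integral_mono integrable_norm Bochner_Integration.integrable_add H1_torus_integrable assms norm_triangle_ineq)
  then show ?thesis using assms by (simp add: H1_torus_integrable)
qed

lemma has_lift_add:
  assumes "has_lift a C" "has_lift b D"
  shows "has_lift (\<lambda>n. a n + b n) (C + D)"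
proof -
  obtain u v where *: "u \<in> H1_torus" "is_bohr_lift a u" "(LINT z|torus_measure. cmod (u z)) \<le> C"
      "v \<in> H1_torus" "is_bohr_lift b v" "(LINT z|torus_measure. cmod (v z)) \<le> D"
    using assms by (auto simp: has_lift_def)
  have "(LINT z|torus_measure. cmod (u z + v z)) \<le> C + D"
    using L1_norm_add_le[OF *(1,4)] *(3,6) by simp
  then show ?thesis unfolding has_lift_def
    by (intro bexI[of _ "\<lambda>z. u z + v z"] conjI H1_torus_add is_bohr_lift_add *)
qed

lemma has_lift_constant: "has_lift (\<lambda>n. if n = 1 then c else 0) (cmod c)"
proof -
  interpret prob_space torus_measure by (rule prob_space_torus)
  have "(\<lambda>z. \<Sum>p\<in>{1::nat}. c * chi p z) \<in> analytic_polynomials"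
    by (rule analytic_polynomials_chi_sum) auto
  then have "(\<lambda>z. c * chi 1 z) \<in> H1_torus" by (simp add: analytic_polynomials_H1_torus)
  moreover have "is_bohr_lift (\<lambda>n. if n = 1 then c else 0) (\<lambda>z. c * chi 1 z)"
    unfolding is_bohr_lift_def using integral_chi[of 1] by (simp add: mult.assoc)
  moreover have "(LINT z|torus_measure. cmod (c * chi 1 z)) \<le> cmod c"
    by (simp add: chi_1 prob_space)
  ultimately show ?thesis unfolding has_lift_def by blast
qed

lemma has_lift_sum:
  assumes "\<And>k. k < K \<Longrightarrow> has_lift (a k) (C k)"
  shows "has_lift (\<lambda>n. \<Sum>k<(K::nat). a k n) (\<Sum>k<K. C k)"
  using assms
proof (induction K)
  case 0
  then show ?case using has_lift_constant[of 0] by simp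
next
  case (Suc K)
  then show ?case using has_lift_add[of _ _ "a K" "C K"] by simp
qed

text \<open>The L^1 limit of the lifts exists, stays in \<open>H1_torus\<close>, and has the limits
  of the coefficients as its Fourier coefficients. This serves twice: from Dirichlet polynomials to
  \<open>H2\<close>, and from \<open>skew_pre\<close> to its completion.\<close>

lemma cauchy_lift_limit:
  assumes u: "\<And>N. u N \<in> H1_torus" "\<And>N. is_bohr_lift (a N) (u N)"
    and cauchy: "\<And>e. e > 0 \<Longrightarrow> \<exists>N. \<forall>i\<ge>N. \<forall>j\<ge>N. (LINT z|torus_measure. cmod (u i z - u j z)) < e"
    and coeff: "\<And>n. n \<ge> 1 \<Longrightarrow> (\<lambda>N. a N n) \<longlonglongrightarrow> b n"
    and bound: "\<And>N. (LINT z|torus_measure. cmod (u N z)) \<le> C"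
  shows "has_lift b C"
proof -
  have int: "integrable torus_measure (u N)" for N using u(1) by (rule H1_torus_integrable)
  obtain v where v: "integrable torus_measure v" "(\<lambda>N. LINT z|torus_measure. cmod (u N z - v z)) \<longlonglongrightarrow> 0"
    using L1_complete[OF int cauchy] by blast
  have "v \<in> H1_torus" by (rule H1_torus_limit[OF u(1) v])
  moreover have "is_bohr_lift b v"
    unfolding is_bohr_lift_def
  proof (intro allI impI)
    fix n :: nat assume "n \<ge> 1"
    have "(\<lambda>N. a N n - (LINT z|torus_measure. v z * cnj (chi n z))) \<longlonglongrightarrow> 0"
    proof (rule Lim_null_comparison[OF _ v(2)], intro always_eventually allI)
      fix N
      have "a N n = (LINT z|torus_measure. u N z * cnj (chi n z))"
        using u(2)[of N] \<open>n \<ge> 1\<close> by (simp add: is_bohr_lift_def)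
      then show "cmod (a N n - (LINT z|torus_measure. v z * cnj (chi n z))) \<le> (LINT z|torus_measure. cmod (u N z - v z))"
        using fourier_coefficient_diff_le[OF int v(1)] by simp
    qed
    then have "(\<lambda>N. a N n) \<longlonglongrightarrow> (LINT z|torus_measure. v z * cnj (chi n z))"
      by (simp add: LIM_zero_iff)
    then show "(LINT z|torus_measure. v z * cnj (chi n z)) = b n"
      using coeff[OF \<open>n \<ge> 1\<close>] LIMSEQ_unique by blast
  qed
  moreover have "(LINT z|torus_measure. cmod (v z)) \<le> C"
  proof (rule LIMSEQ_le_const)
    show "(\<lambda>N. (LINT z|torus_measure. cmod (u N z - v z)) + C) \<longlonglongrightarrow> C"
      using tendsto_add[OF v(2) tendsto_const[of C]] by simp
    have "(LINT z|torus_measure. cmod (v z)) \<le> (LINT z|torus_measure. cmod (u N z - v z)) + C" for N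
      using L1_triangle[OF v(1) int[of N], of "\<lambda>_. 0"] bound[of N] by (simp add: norm_minus_commute)
    then show "\<exists>N. \<forall>n\<ge>N. (LINT z|torus_measure. cmod (v z)) \<le> (LINT z|torus_measure. cmod (u n z - v z)) + C"
      by blast
  qed
  ultimately show ?thesis unfolding has_lift_def by blast
qed

text \<open>The value at \<open>n = 1\<close> is \<open>0\<close>, as a quotient by \<open>ln 1 = 0\<close>.\<close>
definition product_coeff :: "dseries \<Rightarrow> dseries \<Rightarrow> dseries" where
  "product_coeff a b n = (\<Sum>d | d dvd n. a d * (b (n div d) * of_real (ln (real (n div d))))) / of_real (ln (real n))"

lemma integral_paraproduct_chi:
  assumes "n \<ge> 1"
  shows "(LINT z|torus_measure. paraproduct N a b z * cnj (chi n z)) =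
     (\<Sum>(i, j)\<in>{1..N} \<times> {1..N}. if i * j = n then of_real (ln (real j) / (ln (real i) + ln (real j))) * (a i * b j) else 0)"
proof -
  let ?S = "{1..N} \<times> {1..N}"
  let ?w = "\<lambda>(i, j). of_real (ln (real j) / (ln (real i) + ln (real j))) * (a i * b j)"
  have "(LINT z|torus_measure. paraproduct N a b z * cnj (chi n z)) =
      (LINT z|torus_measure. (\<Sum>p\<in>?S. ?w p * (chi (fst p * snd p) z * cnj (chi n z))))"
    unfolding paraproduct_def sum_distrib_right
    by (intro Bochner_Integration.integral_cong refl sum.cong) (auto simp: chi_mult)
  also have "\<dots> = (\<Sum>p\<in>?S. LINT z|torus_measure. ?w p * (chi (fst p * snd p) z * cnj (chi n z)))"
    by (intro Bochner_Integration.integral_sum bounded_measurable_integrable bounded_measurable_intros)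
  also have "\<dots> = (\<Sum>p\<in>?S. ?w p * (if fst p * snd p = n then 1 else 0))"
  proof (intro sum.cong refl)
    fix p assume "p \<in> ?S"
    then have "fst p * snd p \<ge> 1" by (auto simp: Suc_le_eq)
    then show "(LINT z|torus_measure. ?w p * (chi (fst p * snd p) z * cnj (chi n z))) =
       ?w p * (if fst p * snd p = n then 1 else 0)"
      using integral_chi[OF _ assms, of "fst p * snd p"] by simp
  qed
  finally show ?thesis by (simp add: split_def if_distrib cong: if_cong)
qed

text \<open>Once \<open>N \<ge> n\<close>, every factorization n = i j has both factors in the range
  of summation, so the coefficient no longer depends on \<open>N\<close>.\<close>

lemma integral_paraproduct_chi_eq_coeff:
  assumes "n \<ge> 1" "N \<ge> n"
  shows "(LINT z|torus_measure. paraproduct N a b z * cnj (chi n z)) = product_coeff a b n"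
proof -
  let ?g = "\<lambda>(i, j). of_real (ln (real j) / (ln (real i) + ln (real j))) * (a i * b j)"
  have "(LINT z|torus_measure. paraproduct N a b z * cnj (chi n z)) =
      (\<Sum>p\<in>{1..N} \<times> {1..N}. if fst p * snd p = n then ?g p else 0)"
    unfolding integral_paraproduct_chi[OF assms(1)] by (intro sum.cong) auto
  also have "\<dots> = (\<Sum>p\<in>{p\<in>{1..N} \<times> {1..N}. fst p * snd p = n}. ?g p)"
    by (subst sum.inter_filter) auto
  also have "\<dots> = (\<Sum>d | d dvd n. ?g (d, n div d))"
  proof (rule sum.reindex_bij_witness[of _ "\<lambda>d. (d, n div d)" fst])
    fix d assume "d \<in> {d. d dvd n}"
    then obtain k where k: "n = d * k" by (auto elim: dvdE)
    then have "d \<ge> 1" "k \<ge> 1" using assms(1) by auto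
    moreover from this have "d \<le> n" "k \<le> n" using k by auto
    with assms(2) have "d \<le> N" "k \<le> N" by simp_all
    ultimately show "(d, n div d) \<in> {p\<in>{1..N} \<times> {1..N}. fst p * snd p = n}"
      using assms k by auto
  qed (use assms in auto)
  also have "\<dots> = product_coeff a b n"
    unfolding product_coeff_def sum_divide_distrib
  proof (intro sum.cong refl)
    fix d assume "d \<in> {d. d dvd n}"
    then obtain k where k: "n = d * k" by (auto elim: dvdE)
    then have "d \<ge> 1" "k \<ge> 1" using assms(1) by auto
    then have *: "ln (real d) + ln (real (n div d)) = ln (real n)"
      using k by (simp add: ln_mult)
    then show "?g (d, n div d) = a d * (b (n div d) * of_real (ln (real (n div d)))) / of_real (ln (real n))"
      unfolding split_conv * by simp
  qed
  finally show ?thesis .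
qed

lemma paraproduct_H1_torus: "paraproduct N a b \<in> H1_torus"
proof (rule analytic_polynomials_H1_torus)
  let ?c = "\<lambda>p. of_real (ln (real (snd p)) / (ln (real (fst p)) + ln (real (snd p)))) * (a (fst p) * b (snd p))"
  have "paraproduct N a b = (\<lambda>z. \<Sum>p\<in>{1..N} \<times> {1..N}. ?c p * chi (fst p * snd p) z)"
    by (auto simp: paraproduct_def fun_eq_iff chi_mult split_def intro!: sum.cong)
  also have "\<dots> \<in> analytic_polynomials"
    by (rule analytic_polynomials_chi_sum) (auto simp: Suc_le_eq)
  finally show "paraproduct N a b \<in> analytic_polynomials" .
qed

lemma truncated_H2_norm_le_H2_norm:
  assumes "a \<in> H2" shows "truncated_H2_norm N a \<le> H2_norm a"
  using assms unfolding truncated_H2_norm_def H2_norm_def H2_def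
  by (intro real_sqrt_le_mono sum_le_suminf) auto

lemma truncated_H2_norm_mono:
  "(\<And>n. cmod (a n) \<le> cmod (b n)) \<Longrightarrow> truncated_H2_norm N a \<le> truncated_H2_norm N b"
  unfolding truncated_H2_norm_def by (intro real_sqrt_le_mono sum_mono power_mono) auto

lemma truncated_H2_norm_nonneg: "truncated_H2_norm N a \<ge> 0"
  by (simp add: truncated_H2_norm_def sum_nonneg)

text \<open>The Cauchy criterion for the series of squares bounds all blocks that start late enough,
  hence uniformly in \<open>N\<close>.\<close>

lemma truncated_H2_norm_tail_small:
  assumes "a \<in> H2" "e > 0"
  obtains M0 where "\<And>M N. M \<ge> M0 \<Longrightarrow> truncated_H2_norm N (\<lambda>n. if n \<le> M then 0 else a n) < e"
proof -
  have "summable (\<lambda>n. (cmod (a n))\<^sup>2)" using assms by (simp add: H2_def)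
  then obtain M0 where M0: "\<And>m n. m \<ge> M0 \<Longrightarrow> norm (\<Sum>k\<in>{m..<n}. (cmod (a k))\<^sup>2) < e\<^sup>2"
    unfolding summable_Cauchy using assms(2) by (metis zero_less_power)
  have "truncated_H2_norm N (\<lambda>n. if n \<le> M then 0 else a n) < e" if "M \<ge> M0" for M N
  proof -
    have "(\<Sum>n=1..N. (cmod (if n \<le> M then 0 else a n))\<^sup>2) = (\<Sum>n\<in>{Suc M..<Suc N}. (cmod (a n))\<^sup>2)"
      by (intro sum.mono_neutral_cong_right) auto
    also have "\<dots> < e\<^sup>2" using M0[of "Suc M" "Suc N"] that by (simp add: sum_nonneg)
    finally show ?thesis unfolding truncated_H2_norm_def using assms(2) by (intro real_less_lsqrt) auto
  qed
  then show ?thesis using that by blast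
qed

text \<open>Bilinear telescoping: with the cut-offs a_M and b_M, the pair (a, b) minus (a_M, b_M)
  splits into (a - a_M, b) and (a_M, b - b_M), so every summand contains a tail.\<close>

lemma paraproduct_diff:
  assumes "M \<le> N"
  shows "paraproduct N a b z - paraproduct M a b z =
    paraproduct N (\<lambda>n. if n \<le> M then 0 else a n) b z +
    paraproduct N (\<lambda>n. if n \<le> M then a n else 0) (\<lambda>n. if n \<le> M then 0 else b n) z"
proof -
  have "paraproduct M a b z = paraproduct N (\<lambda>n. if n \<le> M then a n else 0) (\<lambda>n. if n \<le> M then b n else 0) z"
    unfolding paraproduct_def using assms
    by (intro sum.mono_neutral_cong_left) (auto split: if_splits)
  then have "paraproduct N (\<lambda>n. if n \<le> M then 0 else a n) b z +
    paraproduct N (\<lambda>n. if n \<le> M then a n else 0) (\<lambda>n. if n \<le> M then 0 else b n) z + paraproduct M a b z =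
    paraproduct N a b z"
    unfolding paraproduct_def by (simp only: sum.distrib[symmetric]) (intro sum.cong refl, auto simp: algebra_simps)
  then show ?thesis by (simp add: algebra_simps)
qed

lemma paraproduct_diff_L1:
  assumes "a \<in> H2" "b \<in> H2" "M \<le> N"
  shows "(LINT z|torus_measure. cmod (paraproduct N a b z - paraproduct M a b z)) \<le>
    7/2 * (truncated_H2_norm N (\<lambda>n. if n \<le> M then 0 else a n) * H2_norm b +
      H2_norm a * truncated_H2_norm N (\<lambda>n. if n \<le> M then 0 else b n))"
proof -
  let ?t = "\<lambda>a n. if n \<le> M then 0 else a n :: complex" and ?a = "\<lambda>n. if n \<le> M then a n else 0"
  have "(LINT z|torus_measure. cmod (paraproduct N a b z - paraproduct M a b z)) \<le>
      (LINT z|torus_measure. cmod (paraproduct N (?t a) b z)) + (LINT z|torus_measure. cmod (paraproduct N ?a (?t b) z))"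
    unfolding paraproduct_diff[OF assms(3)] by (rule L1_norm_add_le[OF paraproduct_H1_torus paraproduct_H1_torus])
  also have "\<dots> \<le> 7/2 * (truncated_H2_norm N (?t a) * truncated_H2_norm N b) + 7/2 * (truncated_H2_norm N ?a * truncated_H2_norm N (?t b))"
    by (intro add_mono paraproduct_L1)
  also have "\<dots> \<le> 7/2 * (truncated_H2_norm N (?t a) * H2_norm b) + 7/2 * (H2_norm a * truncated_H2_norm N (?t b))"
  proof -
    have "truncated_H2_norm N ?a \<le> truncated_H2_norm N a" by (rule truncated_H2_norm_mono) auto
    then have "truncated_H2_norm N ?a \<le> H2_norm a" using truncated_H2_norm_le_H2_norm[OF assms(1)] order_trans by blast
    then show ?thesis
      using truncated_H2_norm_le_H2_norm[OF assms(2)]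
      by (intro add_mono mult_left_mono mult_right_mono truncated_H2_norm_nonneg) auto
  qed
  finally show ?thesis by (simp add: distrib_left)
qed

lemma H2_norm_nonneg: "a \<in> H2 \<Longrightarrow> H2_norm a \<ge> 0"
  by (simp add: H2_norm_def H2_def suminf_nonneg)

lemma has_lift_product:
  assumes "a \<in> H2" "b \<in> H2"
  shows "has_lift (product_coeff a b) (7/2 * (H2_norm a * H2_norm b))"
proof (rule cauchy_lift_limit[where u = "\<lambda>N. paraproduct N a b"
      and a = "\<lambda>N n. LINT z|torus_measure. paraproduct N a b z * cnj (chi n z)"])
  show "paraproduct N a b \<in> H1_torus" for N by (rule paraproduct_H1_torus)
  show "is_bohr_lift (\<lambda>n. LINT z|torus_measure. paraproduct N a b z * cnj (chi n z)) (paraproduct N a b)" for N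
    by (simp add: is_bohr_lift_def)
  show "(\<lambda>N. LINT z|torus_measure. paraproduct N a b z * cnj (chi n z)) \<longlonglongrightarrow> product_coeff a b n"
    if "n \<ge> 1" for n
    by (rule tendsto_eventually)
       (use integral_paraproduct_chi_eq_coeff[OF that] in \<open>auto simp: eventually_sequentially\<close>)
  show "(LINT z|torus_measure. cmod (paraproduct N a b z)) \<le> 7/2 * (H2_norm a * H2_norm b)" for N
    by (rule order_trans[OF paraproduct_L1])
       (intro mult_left_mono mult_mono truncated_H2_norm_le_H2_norm assms truncated_H2_norm_nonneg H2_norm_nonneg, simp)
  fix e :: real assume "e > 0"
  \<comment> \<open>Tails below \<delta> make the difference at most 7/2 \<delta> times the sum of
    the two norms. The summand 1 keeps the denominator positive and makes the final inequality
    strict.\<close>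
  define \<delta> where "\<delta> = e / (7/2 * (H2_norm a + H2_norm b) + 1)"
  have nn: "H2_norm a \<ge> 0" "H2_norm b \<ge> 0" using assms by (auto intro: H2_norm_nonneg)
  have pos: "7/2 * (H2_norm a + H2_norm b) + 1 > 0"
    using nn by (intro add_nonneg_pos mult_nonneg_nonneg add_nonneg_nonneg) auto
  then have "\<delta> > 0" "\<delta> * (7/2 * (H2_norm a + H2_norm b) + 1) = e"
    using \<open>e > 0\<close> by (auto simp: \<delta>_def)
  then have \<delta>: "\<delta> > 0" "7/2 * (\<delta> * H2_norm b + H2_norm a * \<delta>) < e"
    by (auto simp: algebra_simps add_divide_distrib)
  obtain Ma where Ma: "\<And>M N. M \<ge> Ma \<Longrightarrow> truncated_H2_norm N (\<lambda>n. if n \<le> M then 0 else a n) < \<delta>"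
    using truncated_H2_norm_tail_small[OF assms(1) \<delta>(1)] by blast
  obtain Mb where Mb: "\<And>M N. M \<ge> Mb \<Longrightarrow> truncated_H2_norm N (\<lambda>n. if n \<le> M then 0 else b n) < \<delta>"
    using truncated_H2_norm_tail_small[OF assms(2) \<delta>(1)] by blast
  have close: "(LINT z|torus_measure. cmod (paraproduct N a b z - paraproduct M a b z)) < e"
    if "M \<le> N" "M \<ge> max Ma Mb" for M N
  proof -
    have "(LINT z|torus_measure. cmod (paraproduct N a b z - paraproduct M a b z)) \<le>
      7/2 * (truncated_H2_norm N (\<lambda>n. if n \<le> M then 0 else a n) * H2_norm b +
      H2_norm a * truncated_H2_norm N (\<lambda>n. if n \<le> M then 0 else b n))"
      by (rule paraproduct_diff_L1[OF assms that(1)])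
    also have "\<dots> \<le> 7/2 * (\<delta> * H2_norm b + H2_norm a * \<delta>)"
      using Ma[of M N] Mb[of M N] that nn
      by (intro mult_left_mono add_mono mult_right_mono) auto
    finally show ?thesis using \<delta>(2) by linarith
  qed
  show "\<exists>N. \<forall>i\<ge>N. \<forall>j\<ge>N. (LINT z|torus_measure. cmod (paraproduct i a b z - paraproduct j a b z)) < e"
  proof (intro exI[of _ "max Ma Mb"] allI impI)
    fix i j assume "i \<ge> max Ma Mb" "j \<ge> max Ma Mb"
    then show "(LINT z|torus_measure. cmod (paraproduct i a b z - paraproduct j a b z)) < e"
      using close[of i j] close[of j i] by (cases "i \<le> j") (auto simp: norm_minus_commute)
  qed
qed

lemma has_lift_cong:
  "has_lift a C \<Longrightarrow> (\<And>n. n \<ge> 1 \<Longrightarrow> a n = b n) \<Longrightarrow> C \<le> D \<Longrightarrow> has_lift b D"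
  unfolding has_lift_def is_bohr_lift_def by fastforce

section \<open>From products to the skew product space\<close>

lemma skew_rep_deriv:
  "skew_rep F K f g \<Longrightarrow> ds_deriv F n = (\<Sum>k<K. ds_mult (f k) (ds_deriv (g k)) n)"
  by (simp add: skew_rep_def)

text \<open>For n > 1 the coefficient of \<open>F\<close> is recovered from that of the derivative
  by division by -ln n, and the sign cancels against the one in the derivatives of the
  \<open>g k\<close>. The coefficient at 1 is lost in differentiation and is restored by the
  constant \<open>F 1\<close>.\<close>

lemma skew_rep_has_lift:
  assumes "skew_rep F K f g"
  shows "has_lift F (cmod (F 1) + 7/2 * (\<Sum>k<K. H2_norm (f k) * H2_norm (g k)))"
proof -
  have H2: "f k \<in> H2" "g k \<in> H2" if "k < K" for k using assms that by (auto simp: skew_rep_def)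
  have "has_lift (\<lambda>n. (if n = 1 then F 1 else 0) + (\<Sum>k<K. product_coeff (f k) (g k) n))
     (cmod (F 1) + (\<Sum>k<K. 7/2 * (H2_norm (f k) * H2_norm (g k))))"
    by (intro has_lift_add has_lift_constant has_lift_sum has_lift_product H2)
  then show ?thesis
  proof (rule has_lift_cong)
    fix n :: nat assume "n \<ge> 1"
    show "(if n = 1 then F 1 else 0) + (\<Sum>k<K. product_coeff (f k) (g k) n) = F n"
    proof (cases "n = 1")
      case True
      then show ?thesis by (simp add: product_coeff_def)
    next
      case False
      then have "ln (real n) \<noteq> 0" using \<open>n \<ge> 1\<close> by simp
      have "- F n * of_real (ln (real n)) = (\<Sum>k<K. ds_mult (f k) (ds_deriv (g k)) n)"
        using skew_rep_deriv[OF assms] by (simp add: ds_deriv_def)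
      also have "\<dots> = - (\<Sum>k<K. \<Sum>d | d dvd n. f k d * (g k (n div d) * of_real (ln (real (n div d)))))"
        by (simp add: ds_mult_def ds_deriv_def sum_negf)
      finally have "F n = (\<Sum>k<K. \<Sum>d | d dvd n. f k d * (g k (n div d) * of_real (ln (real (n div d))))) / of_real (ln (real n))"
        using \<open>ln (real n) \<noteq> 0\<close> by (simp add: field_simps)
      then show ?thesis using False by (simp add: product_coeff_def sum_divide_distrib)
    qed
  qed (simp add: sum_distrib_left)
qed

text \<open>The infimum may not be attained; the strict inequality selects a representation of cost
  below e - |F 1|. As 1 \<le> 7/2, the constant term is absorbed in the same factor.\<close>

lemma skew_norm_has_lift:
  assumes "F \<in> skew_pre" "skew_norm F < e"
  shows "has_lift F (7/2 * e)"
proof -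
  let ?S = "{(\<Sum>k<K. H2_norm (f k) * H2_norm (g k)) | K f g. skew_rep F K f g}"
  have "?S \<noteq> {}" using assms(1) by (auto simp: skew_pre_def)
  moreover have "Inf ?S < e - cmod (F 1)" using assms(2) by (simp add: skew_norm_def)
  ultimately obtain s where "s \<in> ?S" "s < e - cmod (F 1)" by (rule cInf_lessD[THEN bexE])
  then obtain K f g where rep: "skew_rep F K f g" "(\<Sum>k<K. H2_norm (f k) * H2_norm (g k)) < e - cmod (F 1)"
    by blast
  show ?thesis
    by (rule has_lift_cong[OF skew_rep_has_lift[OF rep(1)]]) (use rep(2) norm_ge_zero[of "F 1"] in argo)+
qed

lemma H2_uminus: "a \<in> H2 \<Longrightarrow> (\<lambda>n. - a n) \<in> H2"
  by (simp add: H2_def)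

lemma sum_lessThan_add: "(\<Sum>k<m + n. h k) = (\<Sum>k<m. h k) + (\<Sum>k<n. h (m + k) :: 'a :: comm_monoid_add)"
  for m n :: nat
  by (induction n) (auto simp: add.assoc)

text \<open>The two representations are concatenated, with the sign placed in the second
  factors.\<close>

lemma skew_pre_diff:
  assumes "F \<in> skew_pre" "G \<in> skew_pre"
  shows "(\<lambda>n. F n - G n) \<in> skew_pre"
proof -
  obtain K f g where F: "skew_rep F K f g" using assms by (auto simp: skew_pre_def)
  obtain L p q where G: "skew_rep G L p q" using assms by (auto simp: skew_pre_def)
  define f' where "f' = (\<lambda>k. if k < K then f k else p (k - K))"
  define g' where "g' = (\<lambda>k. if k < K then g k else (\<lambda>n. - q (k - K) n))"
  have "skew_rep (\<lambda>n. F n - G n) (K + L) f' g'"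
    unfolding skew_rep_def
  proof (intro conjI allI impI ext)
    fix k assume "k < K + L"
    then show "f' k \<in> H2" "g' k \<in> H2"
      using F G by (auto simp: skew_rep_def f'_def g'_def intro!: H2_uminus)
  next
    fix n
    have "ds_mult (f' (K + k)) (ds_deriv (g' (K + k))) n = - ds_mult (p k) (ds_deriv (q k)) n" for k
      by (simp add: f'_def g'_def ds_mult_def ds_deriv_def flip: sum_negf)
    then have "(\<Sum>k<K + L. ds_mult (f' k) (ds_deriv (g' k)) n) = ds_deriv F n - ds_deriv G n"
      unfolding sum_lessThan_add skew_rep_deriv[OF F] skew_rep_deriv[OF G] by (simp add: f'_def g'_def sum_negf)
    then show "ds_deriv (\<lambda>n. F n - G n) n = (\<Sum>k<K + L. ds_mult (f' k) (ds_deriv (g' k)) n)"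
      by (simp add: ds_deriv_def algebra_simps)
  qed
  then show ?thesis using assms by (auto simp: skew_pre_def)
qed

lemma H1_torus_sum:
  "(\<And>i. i \<in> I \<Longrightarrow> w i \<in> H1_torus) \<Longrightarrow> (\<lambda>z. \<Sum>i\<in>I. w i z) \<in> H1_torus"
proof (induction I rule: infinite_finite_induct)
  case (insert i I)
  then show ?case using H1_torus_add[of "w i" "\<lambda>z. \<Sum>i\<in>I. w i z"] by simp
qed (use analytic_polynomials_H1_torus[OF analytic_polynomials_chi_sum[of "{}"]] in auto)

lemma L1_norm_sum_le:
  assumes "\<And>i. i \<in> I \<Longrightarrow> w i \<in> H1_torus"
  shows "(LINT z|torus_measure. cmod (\<Sum>i\<in>I. w i z)) \<le> (\<Sum>i\<in>I. (LINT z|torus_measure. cmod (w i z)))"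
proof -
  have "(LINT z|torus_measure. cmod (\<Sum>i\<in>I. w i z)) \<le> (LINT z|torus_measure. (\<Sum>i\<in>I. cmod (w i z)))"
    by (intro integral_mono integrable_norm Bochner_Integration.integrable_sum H1_torus_integrable assms norm_sum)
  also have "\<dots> = (\<Sum>i\<in>I. (LINT z|torus_measure. cmod (w i z)))"
    by (intro Bochner_Integration.integral_sum integrable_norm H1_torus_integrable assms)
  finally show ?thesis .
qed

lemma half_power_sum_le: "(\<Sum>i\<in>{m..<n}. (1/2 :: real) ^ i) \<le> 2 * (1/2) ^ m"
proof (cases "m \<le> n")
  case True
  then have "(\<Sum>i\<in>{m..<n}. (1/2 :: real) ^ i) = 2 * (1/2) ^ m - 2 * (1/2) ^ n"
    by (induction rule: dec_induct) auto
  then show ?thesis by simp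
qed auto

text \<open>A skew-norm Cauchy sequence is thinned until consecutive differences have norm below
  (1/2)^k. Lifts of these differences form an absolutely convergent series in L^1, and its sum is a
  lift of the coefficientwise limit.\<close>

theorem corollary9: "skew_product_space \<subseteq> H1"
proof
  fix F assume "F \<in> skew_product_space"
  then obtain X where X: "\<And>m. X m \<in> skew_pre" "\<And>n. (\<lambda>m. X m n) \<longlonglongrightarrow> F n"
      "\<forall>\<epsilon>>0. \<exists>N. \<forall>m\<ge>N. \<forall>l\<ge>N. skew_norm (\<lambda>n. X m n - X l n) < \<epsilon>"
    unfolding skew_product_space_def by blast
  have "X m 0 = 0" for m using X(1) by (simp add: skew_pre_def)
  then have F0: "F 0 = 0" using X(2)[of 0] by (simp add: LIMSEQ_const_iff)
  have "\<exists>N. \<forall>m\<ge>N. \<forall>l\<ge>N. skew_norm (\<lambda>n. X m n - X l n) < (1/2) ^ k" for k :: nat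
    using X(3) by simp
  then obtain N where N: "\<And>k m l. m \<ge> N k \<Longrightarrow> l \<ge> N k \<Longrightarrow> skew_norm (\<lambda>n. X m n - X l n) < (1/2) ^ k"
    by metis
  \<comment> \<open>The partial sums of \<open>N\<close> place both \<open>s k\<close> and
    \<open>s (Suc k)\<close> beyond \<open>N k\<close>; the summand \<open>k\<close> makes
    \<open>s\<close> tend to infinity.\<close>
  define s where "s = (\<lambda>k. k + (\<Sum>i\<le>k. N i))"
  have s: "s k \<ge> N k" "s (Suc k) \<ge> N k" "s k \<ge> k" for k
  proof -
    have "N k \<le> (\<Sum>i\<le>k. N i)" by (rule member_le_sum) auto
    then show "s k \<ge> N k" "s (Suc k) \<ge> N k" "s k \<ge> k" by (auto simp: s_def)
  qed
  \<comment> \<open>Lifts are chosen for the differences and summed, so no uniqueness of lifts is needed.\<close>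
  have "has_lift (\<lambda>n. X (s (Suc k)) n - X (s k) n) (7/2 * (1/2) ^ k)" for k
    by (rule skew_norm_has_lift[OF skew_pre_diff[OF X(1) X(1)] N[OF s(2,1)]])
  then obtain w where w: "\<And>k. w k \<in> H1_torus" "\<And>k. is_bohr_lift (\<lambda>n. X (s (Suc k)) n - X (s k) n) (w k)"
      "\<And>k. (LINT z|torus_measure. cmod (w k z)) \<le> 7/2 * (1/2) ^ k"
    unfolding has_lift_def by metis
  have "has_lift (X (s 0)) (7/2 * (skew_norm (X (s 0)) + 1))"
    by (rule skew_norm_has_lift[OF X(1)]) simp
  then obtain w0 where w0: "w0 \<in> H1_torus" "is_bohr_lift (X (s 0)) w0"
    unfolding has_lift_def by blast
  define u where "u = (\<lambda>k z. w0 z + (\<Sum>i<k. w i z))"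
  have u: "u k \<in> H1_torus" for k
    unfolding u_def by (intro H1_torus_add H1_torus_sum w w0)
  \<comment> \<open>The tail of the geometric series with terms 7/2 (1/2)^i is 7 (1/2)^m. For m = 0
    this bounds all \<open>u k\<close> uniformly; for large m it yields the Cauchy property.\<close>
  have partial: "(LINT z|torus_measure. cmod (\<Sum>i\<in>{m..<n}. w i z)) \<le> 7 * (1/2) ^ m" for m n
  proof -
    have "(LINT z|torus_measure. cmod (\<Sum>i\<in>{m..<n}. w i z)) \<le> (\<Sum>i\<in>{m..<n}. 7/2 * (1/2) ^ i)"
      by (rule order_trans[OF L1_norm_sum_le[OF w(1)] sum_mono[OF w(3)]])
    also have "\<dots> \<le> 7 * (1/2) ^ m"
      using half_power_sum_le[of m n] unfolding sum_distrib_left[symmetric] by simp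
    finally show ?thesis .
  qed
  have "has_lift F ((LINT z|torus_measure. cmod (w0 z)) + 7)"
  proof (rule cauchy_lift_limit[where u = u and a = "\<lambda>k. X (s k)"])
    show "u k \<in> H1_torus" for k by (rule u)
    show "is_bohr_lift (X (s k)) (u k)" for k
    proof (induction k)
      case 0
      then show ?case using w0 by (simp add: u_def)
    next
      case (Suc k)
      have "(\<lambda>n. X (s k) n + (X (s (Suc k)) n - X (s k) n)) = X (s (Suc k))"
        "(\<lambda>z. u k z + w k z) = u (Suc k)"
        by (auto simp: u_def)
      then show ?case using is_bohr_lift_add[OF u[of k] w(1)[of k] Suc w(2)[of k]] by (simp only:)
    qed
    show "(LINT z|torus_measure. cmod (u k z)) \<le> (LINT z|torus_measure. cmod (w0 z)) + 7" for k
      using L1_norm_add_le[OF w0(1) H1_torus_sum[of "{0..<k}" w, OF w(1)]] partial[of 0 k]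
      by (simp add: u_def lessThan_atLeast0)
    have "filterlim s at_top sequentially"
      by (rule filterlim_at_top_mono[OF filterlim_ident]) (auto simp: s)
    then show "(\<lambda>k. X (s k) n) \<longlonglongrightarrow> F n" for n
      by (rule filterlim_compose[OF X(2)])
    fix e :: real assume "e > 0"
    then obtain m where m: "(1/2) ^ m < e / 7" using real_arch_pow_inv[of "e / 7" "1/2"] by auto
    have close: "(LINT z|torus_measure. cmod (u i z - u j z)) < e" if "m \<le> j" "j \<le> i" for i j
    proof -
      have "u i z - u j z = (\<Sum>k\<in>{j..<i}. w k z)" for z
        using sum.atLeastLessThan_concat[of 0 j i "\<lambda>k. w k z"] that
        by (simp add: u_def lessThan_atLeast0 algebra_simps)
      then have "(LINT z|torus_measure. cmod (u i z - u j z)) \<le> 7 * (1/2) ^ j" using partial by simp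
      also have "\<dots> \<le> 7 * (1/2) ^ m" using that by (simp add: power_decreasing)
      finally show ?thesis using m by simp
    qed
    show "\<exists>N. \<forall>i\<ge>N. \<forall>j\<ge>N. (LINT z|torus_measure. cmod (u i z - u j z)) < e"
    proof (intro exI[of _ m] allI impI)
      fix i j assume "i \<ge> m" "j \<ge> m"
      then show "(LINT z|torus_measure. cmod (u i z - u j z)) < e"
        using close[of i j] close[of j i] by (cases "i \<le> j") (auto simp: norm_minus_commute)
    qed
  qed
  then show "F \<in> H1" using F0 by (auto simp: H1_def has_lift_def)
qed

end
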